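(* Let $d,L,N\ge1$ and let $\nu$ be a discrete probability measure on $\mathcal{G}_{\le L}(\mathbb{R}^d)$ supported on points $\mathbf{x}^{(1)},\dots,\mathbf{x}^{(N)}$ with $\nu(\{\mathbf{x}^{(i)}\})=w^{(i)}$, $\sum_{i=1}^N w^{(i)}=1$, where $$\mathbf{x}^{(i)}=\exp\Big(\sum_{j=1}^{B}c^{(i)}_j\mathcal{B}_j\Big),\qquad c^{(i)}\in\mathbb{R}^B,\quad 1\le i\le N .$$ Then the coefficient vector $m\in\mathbb{R}^B$ of the group mean $\mathbf{m}=\exp\big(\sum_{j=1}^B m_j\mathcal{B}_j\big)$ of $\nu$ can be computed recursively by the closed formula $$m_j=\sum_{i=1}^N w^{(i)}\Big(c^{(i)}_j+p_j\big(-m_1,\dots,-m_{j-1},c^{(i)}_1,\dots,c^{(i)}_{j-1}\big)\Big)$$ for every $1\le j\le B$.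
   Context: $T_{\le L}(\mathbb{R}^d)$ is the truncated tensor algebra: the real span of the words of length $\le L$ over the letters $1<\dots<d$ with concatenation product (products of total length $>L$ are $0$) and unit the empty word $\mathsf{e}$; $[v,w]=vw-wv$. $\mathfrak{g}_{\le L}=\mathfrak{g}_{\le L}(\mathbb{R}^d)$ is the smallest sub-Lie algebra containing the letters, and $\mathcal{G}_{\le L}(\mathbb{R}^d)=\exp(\mathfrak{g}_{\le L})$ is a group; $\exp$ is a bijection $\mathfrak{g}_{\le L}\to\mathcal{G}_{\le L}(\mathbb{R}^d)$ with inverse $\log$ (the usual power series). A group mean of a probability measure $\nu$ is an element $\mathbf{m}\in\mathcal{G}_{\le L}(\mathbb{R}^d)$ with $0=\int\log(\mathbf{m}^{-1}\mathbf{x})\,\nu(\mathrm d\mathbf{x})$ (here it exists and is unique). Lyndon basis: a nonempty word is Lyndon if it is lexicographically strictly smaller than each of its nonempty proper suffixes. A Lyndon word $w$ of length $\ge2$ has the standard factorization $w=uv$ with $u,v$ Lyndon and $v$ as long as possible; set $\mathcal{B}_w=w$ for a letter and $\mathcal{B}_w=[\mathcal{B}_u,\mathcal{B}_v]$ otherwise. Order the Lyndon words of length $\le L$ by length, then lexicographically within each length, as $w_1,\dots,w_B$ and write $\mathcal{B}_j=\mathcal{B}_{w_j}$; these form a basis of $\mathfrak{g}_{\le L}$, $B=\dim\mathfrak{g}_{\le L}$, with dual basis $\mathcal{B}_j^*$. Polynomials $p_j$: let $R=\mathbb{R}[M_1,\dots,M_B,C_1,\dots,C_B]$, extend $\mathfrak{g}_{\le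 L}$ (and $\exp$, $\log$, $\mathcal{B}_j^*$) to coefficients in $R$, and put $X=\sum_b M_b\mathcal{B}_b$, $Y=\sum_b C_b\mathcal{B}_b$. Then $p_j\in\mathbb{R}[M_1,\dots,M_{j-1},C_1,\dots,C_{j-1}]$ is the unique polynomial with $\mathcal{B}_j^*(\log(\exp(X)\exp(Y)))=M_j+C_j+p_j$. *)

theory Defs
  imports
    "HOL-Probability.Probability_Measure"
    "HOL-Algebra.Group"
    "HOL-Library.Poly_Mapping"
    "HOL-Library.List_Lenlexorder"
    "HOL-Library.Sublist"
begin

section \<open>Truncated tensors\<close>

text \<open>
  A word over the letters \<open>1 < \<dots> < d\<close> is a list of natural numbers, and a tensor is the function
  sending each word to its coefficient. Coefficients are polymorphic, so that the same operations
  serve the real tensors and the tensors with coefficients in a polynomial ring.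
\<close>

type_synonym 'a tens = "nat list \<Rightarrow> 'a"

definition tens_space :: "nat \<Rightarrow> nat \<Rightarrow> 'a::comm_ring_1 tens set" where
  "tens_space d L = {f. \<forall>v. f v \<noteq> 0 \<longrightarrow> set v \<subseteq> {1..d} \<and> length v \<le> L}"

definition tens_word :: "nat list \<Rightarrow> 'a::comm_ring_1 tens" where
  "tens_word w = (\<lambda>v. if v = w then 1 else 0)"

text \<open>Bilinear extension of concatenation: the coefficient of \<open>v\<close> sums over all ways of
  cutting \<open>v\<close> into a prefix and a suffix.\<close>

definition tens_mult :: "nat \<Rightarrow> 'a::comm_ring_1 tens \<Rightarrow> 'a tens \<Rightarrow> 'a tens" where
  "tens_mult L f g =
     (\<lambda>v. if length v \<le> L then \<Sum>k\<le>length v. f (take k v) * g (drop k v) else 0)"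

definition tens_bracket :: "nat \<Rightarrow> 'a::comm_ring_1 tens \<Rightarrow> 'a tens \<Rightarrow> 'a tens" where
  "tens_bracket L f g = (\<lambda>v. tens_mult L f g v - tens_mult L g f v)"

primrec tens_pow :: "nat \<Rightarrow> 'a::comm_ring_1 tens \<Rightarrow> nat \<Rightarrow> 'a tens" where
  "tens_pow L f 0 = tens_word []"
| "tens_pow L f (Suc k) = tens_mult L f (tens_pow L f k)"

text \<open>
  The power series stop at degree \<open>L\<close>: they are only used for \<open>exp f\<close> with \<open>f [] = 0\<close> and for
  \<open>log g\<close> with \<open>g [] = 1\<close>, where all higher powers of \<open>f\<close> and of \<open>g - 1\<close> vanish.
\<close>

definition tens_exp :: "nat \<Rightarrow> 'a::{comm_ring_1, real_algebra_1} tens \<Rightarrow> 'a tens" where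
  "tens_exp L f = (\<lambda>v. \<Sum>k\<le>L. (1 / fact k) *\<^sub>R tens_pow L f k v)"

definition tens_log :: "nat \<Rightarrow> 'a::{comm_ring_1, real_algebra_1} tens \<Rightarrow> 'a tens" where
  "tens_log L g =
     (\<lambda>v. \<Sum>k=1..L. ((-1) ^ (k + 1) / real k) *\<^sub>R tens_pow L (\<lambda>u. g u - tens_word [] u) k v)"


section \<open>The free nilpotent Lie algebra and its group\<close>

definition lie_subalgebra :: "nat \<Rightarrow> nat \<Rightarrow> real tens set \<Rightarrow> bool" where
  "lie_subalgebra d L S \<longleftrightarrow>
     S \<subseteq> tens_space d L \<and>
     (\<lambda>_. 0) \<in> S \<and>
     (\<forall>f\<in>S. \<forall>g\<in>S. (\<lambda>v. f v + g v) \<in> S) \<and>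
     (\<forall>a. \<forall>f\<in>S. (\<lambda>v. a * f v) \<in> S) \<and>
     (\<forall>f\<in>S. \<forall>g\<in>S. tens_bracket L f g \<in> S)"

definition free_lie :: "nat \<Rightarrow> nat \<Rightarrow> real tens set" where
  "free_lie d L = lie_subalgebra d L hull ((\<lambda>i. tens_word [i]) ` {1..d})"

definition lie_group :: "nat \<Rightarrow> nat \<Rightarrow> real tens monoid" where
  "lie_group d L =
     \<lparr>carrier = tens_exp L ` free_lie d L, mult = tens_mult L, one = tens_word []\<rparr>"

text \<open>The integral of the tensor-valued function is taken coefficientwise.\<close>

definition is_group_mean :: "nat \<Rightarrow> nat \<Rightarrow> real tens measure \<Rightarrow> real tens \<Rightarrow> bool" where
  "is_group_mean d L \<nu> m \<longleftrightarrow>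
     m \<in> carrier (lie_group d L) \<and>
     (\<forall>v. has_bochner_integral \<nu>
            (\<lambda>x. tens_log L (inv\<^bsub>lie_group d L\<^esub> m \<otimes>\<^bsub>lie_group d L\<^esub> x) v) 0)"

definition group_mean :: "nat \<Rightarrow> nat \<Rightarrow> real tens measure \<Rightarrow> real tens" where
  "group_mean d L \<nu> = (THE m. is_group_mean d L \<nu> m)"


section \<open>The Lyndon basis\<close>

definition lyndon :: "nat list \<Rightarrow> bool" where
  "lyndon w \<longleftrightarrow>
     w \<noteq> [] \<and> (\<forall>v. v \<noteq> [] \<and> strict_suffix v w \<longrightarrow> (w, v) \<in> lexord {(a, b). a < b})"

definition lyndon_splits :: "nat list \<Rightarrow> nat set" where
  "lyndon_splits w =
     {k. 0 < k \<and> k < length w \<and> lyndon (take k w) \<and> lyndon (drop k w)}"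

text \<open>
  The standard factorization cuts at the least possible position, which makes the right factor as
  long as possible. Every Lyndon word of length at least two has such a position, so that among
  Lyndon words the second case of the recursion concerns exactly the letters.
\<close>

function lyndon_bracket :: "nat \<Rightarrow> nat list \<Rightarrow> 'a::comm_ring_1 tens" where
  "lyndon_bracket L w =
     (if lyndon_splits w \<noteq> {}
      then tens_bracket L
             (lyndon_bracket L (take (LEAST k. k \<in> lyndon_splits w) w))
             (lyndon_bracket L (drop (LEAST k. k \<in> lyndon_splits w) w))
      else tens_word w)"
  by auto

lemma Least_lyndon_splits:
  assumes "lyndon_splits w \<noteq> {}"
  shows "0 < (LEAST k. k \<in> lyndon_splits w)" "(LEAST k. k \<in> lyndon_splits w) < length w"
proof -
  have "(LEAST k. k \<in> lyndon_splits w) \<in> lyndon_splits w"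
    using assms by (metis LeastI ex_in_conv)
  then show "0 < (LEAST k. k \<in> lyndon_splits w)" "(LEAST k. k \<in> lyndon_splits w) < length w"
    by (simp_all add: lyndon_splits_def)
qed

termination lyndon_bracket
proof (relation "Wellfounded.measure (\<lambda>(L, w). length w)", goal_cases)
  case (2 L w)
  then show ?case using Least_lyndon_splits[of w] by simp
next
  case (3 L w)
  then show ?case using Least_lyndon_splits[of w] by simp
qed simp

declare lyndon_bracket.simps [simp del]

definition lyndon_words :: "nat \<Rightarrow> nat \<Rightarrow> nat list set" where
  "lyndon_words d L = {w. lyndon w \<and> set w \<subseteq> {1..d} \<and> length w \<le> L}"

definition lie_dim :: "nat \<Rightarrow> nat \<Rightarrow> nat" where
  "lie_dim d L = card (lyndon_words d L)"

text \<open>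
  The order on lists used by \<^const>\<open>sorted_list_of_set\<close> is the one of
  \<^theory>\<open>HOL-Library.List_Lenlexorder\<close>: first by length, then lexicographically.
  Basis elements are numbered from \<open>1\<close>.
\<close>

definition lie_basis :: "nat \<Rightarrow> nat \<Rightarrow> nat \<Rightarrow> 'a::comm_ring_1 tens" where
  "lie_basis d L j = lyndon_bracket L (sorted_list_of_set (lyndon_words d L) ! (j - 1))"

definition lie_comb :: "nat \<Rightarrow> nat \<Rightarrow> (nat \<Rightarrow> 'a) \<Rightarrow> 'a::comm_ring_1 tens" where
  "lie_comb d L z = (\<lambda>v. \<Sum>b=1..lie_dim d L. z b * lie_basis d L b v)"

text \<open>The dual basis: \<open>lie_dual d L j f\<close> is the \<open>j\<close>-th coordinate of \<open>f\<close> in the Lyndon basis.\<close>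

definition lie_dual :: "nat \<Rightarrow> nat \<Rightarrow> nat \<Rightarrow> 'a::comm_ring_1 tens \<Rightarrow> 'a" where
  "lie_dual d L j f =
     (THE z. (\<forall>b. b \<notin> {1..lie_dim d L} \<longrightarrow> z b = 0) \<and> f = lie_comb d L z) j"


section \<open>Multivariate polynomials\<close>

instantiation poly_mapping :: (type, real_vector) real_vector
begin

lift_definition scaleR_poly_mapping :: "real \<Rightarrow> ('a \<Rightarrow>\<^sub>0 'b) \<Rightarrow> 'a \<Rightarrow>\<^sub>0 'b"
  is "\<lambda>r f k. r *\<^sub>R f k"
  by (erule finite_subset[rotated]) auto

instance
  by standard (transfer, simp add: fun_eq_iff scaleR_add_right scaleR_add_left)+

end

lemma scaleR_poly_mapping_conv_mult:
  fixes p :: "'a::comm_monoid_add \<Rightarrow>\<^sub>0 'b::{comm_ring_1, real_algebra_1}"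
  shows "r *\<^sub>R p = Poly_Mapping.single 0 (of_real r) * p"
proof -
  have "r *\<^sub>R p = Poly_Mapping.map ((*) (of_real r)) p"
    by (rule poly_mapping_eqI)
       (simp add: scaleR_poly_mapping.rep_eq map.rep_eq when_def scaleR_conv_of_real)
  then show ?thesis by (simp add: mult_map_scale_conv_mult)
qed

instance poly_mapping :: (comm_monoid_add, "{comm_ring_1, real_algebra_1}") real_algebra_1
  by standard (simp_all add: scaleR_poly_mapping_conv_mult ac_simps)

type_synonym 'v rpoly = "('v \<Rightarrow>\<^sub>0 nat) \<Rightarrow>\<^sub>0 real"

definition rpoly_var :: "'v \<Rightarrow> 'v rpoly" where
  "rpoly_var x = Poly_Mapping.single (Poly_Mapping.single x 1) 1"

definition rpoly_vars :: "'v rpoly \<Rightarrow> 'v set" where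
  "rpoly_vars p = (\<Union>\<alpha>\<in>Poly_Mapping.keys p. Poly_Mapping.keys \<alpha>)"

definition rpoly_eval :: "('v \<Rightarrow> real) \<Rightarrow> 'v rpoly \<Rightarrow> real" where
  "rpoly_eval \<sigma> p = (\<Sum>\<alpha>\<in>Poly_Mapping.keys p. Poly_Mapping.lookup p \<alpha> *
     (\<Prod>x\<in>Poly_Mapping.keys \<alpha>. \<sigma> x ^ Poly_Mapping.lookup \<alpha> x))"

text \<open>The variable \<open>M\<^sub>b\<close> is indexed by \<open>Inl b\<close> and the variable \<open>C\<^sub>b\<close> by \<open>Inr b\<close>.\<close>

definition bch_poly :: "nat \<Rightarrow> nat \<Rightarrow> nat \<Rightarrow> (nat + nat) rpoly" where
  "bch_poly d L j = (THE p.
     rpoly_vars p \<subseteq> Inl ` {1..<j} \<union> Inr ` {1..<j} \<and>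
     lie_dual d L j
       (tens_log L
         (tens_mult L
           (tens_exp L (lie_comb d L (\<lambda>b. rpoly_var (Inl b))))
           (tens_exp L (lie_comb d L (\<lambda>b. rpoly_var (Inr b))))))
     = rpoly_var (Inl j) + rpoly_var (Inr j) + p)"

text \<open>
  The value \<open>p\<^sub>j(a\<^sub>1, \<dots>, a\<^bsub>j-1\<^esub>, c\<^sub>1, \<dots>, c\<^bsub>j-1\<^esub>)\<close>. Entries of \<open>a\<close> and \<open>c\<close> from index \<open>j\<close>
  onwards are discarded, so that this value visibly depends on the first \<open>j - 1\<close> entries only.
\<close>

definition bch_eval :: "nat \<Rightarrow> nat \<Rightarrow> nat \<Rightarrow> (nat \<Rightarrow> real) \<Rightarrow> (nat \<Rightarrow> real) \<Rightarrow> real" where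
  "bch_eval d L j a c =
     rpoly_eval (case_sum (\<lambda>b. if b < j then a b else 0) (\<lambda>b. if b < j then c b else 0))
       (bch_poly d L j)"

end

theory Submission
  imports Defs "HOL-Computational_Algebra.Formal_Power_Series"
begin

text \<open>
  If \<open>m = exp (\<Sum> m\<^sub>j B\<^sub>j)\<close> and \<open>x = exp (\<Sum> c\<^sub>j B\<^sub>j)\<close>, then \<open>m\<close> has inverse \<open>exp (\<Sum> - m\<^sub>j B\<^sub>j)\<close>, and the
  \<open>j\<close>-th coordinate of \<open>log (m\<^sup>-\<^sup>1 x)\<close> is \<open>- m\<^sub>j + c\<^sub>j + p\<^sub>j (- m, c)\<close>, where \<open>p\<^sub>j\<close> involves coordinates of
  index below \<open>j\<close> only. Averaging over the weights, which sum to one, turns the defining equation of a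
  group mean into \<open>m\<^sub>j = \<Sum>\<^sub>i w\<^sub>i (c\<^sub>i\<^sub>j + p\<^sub>j (- m, c\<^sub>i))\<close> for all \<open>j\<close>
  (\<open>is_group_mean_iff_recursion\<close>). This system is triangular, so it has exactly one solution; hence
  the group mean exists and is unique, the description that defines it denotes a group mean, and the
  coordinates of that mean satisfy the formula.

  What has to be built is the coordinate description of the Baker--Campbell--Hausdorff product
  \<open>bch L f g = log (exp f exp g)\<close>. Everything rests on one notion. A tensor is primitive when it
  vanishes on the empty word and is orthogonal to all shuffles of two nonempty words. Three facts
  connect it with the Lyndon basis, over any commutative real algebra of coefficients:

  \<^item> The coproduct dual to shuffling is multiplicative (\<open>coprod_mult\<close>). So exponentials of primitive
    tensors are group-like, products of group-like tensors are group-like, logarithms of group-like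
    tensors are primitive, and \<open>bch L f g\<close> is primitive when \<open>f\<close> and \<open>g\<close> are
    (\<open>primitive_bch\<close>). Brackets of primitive tensors are primitive as well.

  \<^item> A nonempty word \<open>w\<close> that is not Lyndon splits as \<open>w = u v\<close> such that \<open>w\<close> is the largest shuffle of \<open>u\<close> and
    \<open>v\<close> (\<open>not_lyndon_split\<close>). Therefore the smallest word in the support of a primitive tensor is
    Lyndon (\<open>primitive_smallest_word_lyndon\<close>).

  \<^item> The Lyndon bracket of \<open>w\<close> is \<open>w\<close> plus larger words of the same length
    (\<open>lyndon_bracket_support\<close>). Subtracting multiples of Lyndon brackets therefore pushes the smallest
    word upwards until nothing is left (\<open>primitive_lyndon_combination\<close>), and the coefficients can be
    read off successively (\<open>lyndon_coefficients_in\<close>).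

  Consequently the Lyndon brackets form a basis of the primitive tensors, the real primitive tensors
  are the free Lie algebra (\<open>free_lie_eq_lie_comb\<close>), and \<open>bch\<close> of two combinations of basis elements
  is again such a combination (\<open>bch_lie_comb\<close>).

  With indeterminate coefficients this yields the polynomials. In degree \<open>n\<close> the product differs from
  \<open>f + g\<close> by a tensor that depends on the parts of \<open>f\<close> and \<open>g\<close> of degree below \<open>n\<close>
  (\<open>bch_top_degree\<close>); as the basis is ordered by length, only variables of index below \<open>j\<close> occur in
  \<open>p\<^sub>j\<close> (\<open>bch_coordinate_lower_variables\<close>). Evaluating the indeterminates gives the real statement
  (\<open>bch_lie_comb_eval\<close>).
\<close>

unbundle no vec_syntax
unbundle fps_syntax

section \<open>Lexicographic order, shuffles and Lyndon words\<close>

lemma lexord_conv_lexordp: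
  "(u, v) \<in> lexord {(a, b). a < b} \<longleftrightarrow> \<not> lexordp_eq v (u :: 'a::linorder list)"
  by (metis lexordp_conv_lexord lexordp_conv_lexordp_eq lexordp_eq_linear)

lemma lexordp_eq_append_cancel [simp]:
  "lexordp_eq (p @ u) (p @ v) \<longleftrightarrow> lexordp_eq u (v :: 'a::linorder list)"
  by (induction p) auto

lemma lexordp_eq_append_mono:
  assumes "lexordp_eq u u'" "length u = length u'" "lexordp_eq v (v' :: 'a::linorder list)"
  shows "lexordp_eq (u @ v) (u' @ v')"
  using assms(1,3,2) by (induction rule: lexordp_eq.induct) auto

lemma lexordp_eq_appendD:
  assumes "lexordp_eq (u @ s) (v :: 'a::linorder list)"
  shows "lexordp_eq u v"
  using assms lexordp_eq_pref lexordp_eq_trans by blast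

text \<open>
  If \<open>u\<close> exceeds \<open>v\<close> because of a letter, appending words does not change this; the other possibility is
  that \<open>u\<close> extends \<open>v\<close>.
\<close>

lemma not_lexordp_eq_append:
  assumes "\<not> lexordp_eq u (v :: 'a::linorder list)"
  shows "(\<exists>t. t \<noteq> [] \<and> u = v @ t) \<or> \<not> lexordp_eq (u @ s) (v @ s')"
  using assms
proof (induction u arbitrary: v)
  case (Cons a u)
  show ?case
  proof (cases v)
    case v: (Cons b v')
    show ?thesis
    proof (cases "a = b")
      case True
      with Cons.prems v have "\<not> lexordp_eq u v'" by simp
      from Cons.IH[OF this] show ?thesis using v True by auto
    qed (use Cons.prems v in auto)
  qed simp
qed simp

text \<open>
  The largest merge of two words is found greedily, by always drawing from the word that is
  larger at present. This is the exchange step behind it: if \<open>a \<ge> b\<close>, then moving a prefix \<open>p\<close> from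
  \<open>a\<close> to \<open>b\<close> can only help, because it frees the larger word \<open>a\<close> for immediate use. The
  statement carries an arbitrary \<open>p\<close> since the letters common to \<open>a\<close> and \<open>b\<close> have to be moved into it.
\<close>

lemma shuffle_transfer_prefix:
  assumes "lexordp_eq b (a :: 'a::linorder list)" "t \<in> shuffles (p @ a) b"
  shows "\<exists>t'\<in>shuffles a (p @ b). lexordp_eq t t'"
  using assms
proof (induction t arbitrary: a b p)
  case Nil
  then show ?case by auto
next
  case (Cons z t)
  show ?case
  proof (cases "p = [] \<or> b = []")
    case True
    then show ?thesis
    proof
      assume "p = []" then show ?thesis using Cons.prems lexordp_eq_refl by auto
    next
      assume b: "b = []"
      have "p @ a \<in> shuffles a p"
        by (induction p) (auto simp: shuffles_commutes intro: Cons_in_shuffles_rightI)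
      then show ?thesis using Cons.prems b lexordp_eq_refl by auto
    qed
  next
    case False
    then obtain y p' where p: "p = y # p'" by (cases p) auto
    from False obtain z' b' where b: "b = z' # b'" by (cases b) auto
    from Cons.prems(2) p b consider "z = y" "t \<in> shuffles (p' @ a) b" | "z = z'" "t \<in> shuffles (p @ a) b'"
      by (auto simp: Cons_in_shuffles_iff)
    then show ?thesis
    proof cases
      case 1
      from Cons.IH[OF Cons.prems(1) 1(2)] obtain t' where "t' \<in> shuffles a (p' @ b)" "lexordp_eq t t'" by blast
      then have "y # t' \<in> shuffles a (p @ b)" "lexordp_eq (z # t) (y # t')"
        using 1 p by (auto intro: Cons_in_shuffles_rightI)
      then show ?thesis by blast
    next
      case 2
      from Cons.prems(1) b obtain x a' where a: "a = x # a'" by (cases a) auto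
      \<comment> \<open>The shuffle draws from \<open>b\<close>; drawing from \<open>a\<close> instead is strictly better or a tie.\<close>
      show ?thesis
      proof (cases "z' < x")
        case True
        obtain t' where "t' \<in> shuffles a' (p @ b)" using splice_in_shuffles by blast
        then have "x # t' \<in> shuffles a (p @ b)" using a by (auto intro: Cons_in_shuffles_leftI)
        then show ?thesis using True 2 by (metis lexordp_eq_simps(3))
      next
        case False
        with Cons.prems(1) a b have x: "x = z'" "lexordp_eq b' a'" by auto
        \<comment> \<open>In a tie the letter joins the prefix.\<close>
        have "t \<in> shuffles ((p @ [z']) @ a') b'" using 2 a x by simp
        from Cons.IH[OF x(2) this] obtain t' where "t' \<in> shuffles a' (p @ b)" "lexordp_eq t t'"
          using b by auto
        then have "x # t' \<in> shuffles a (p @ b)" "lexordp_eq (z # t) (x # t')"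
          using a 2 x by (auto intro: Cons_in_shuffles_leftI)
        then show ?thesis by blast
      qed
    qed
  qed
qed

text \<open>
  As long as letters of \<open>u\<close> remain, what remains of \<open>u\<close> is a suffix and so at least \<open>v\<close>; the greedy
  merge uses up \<open>u\<close> first and results in \<open>u @ v\<close>.
\<close>

lemma shuffles_le_append:
  assumes "\<And>s. suffix s u \<Longrightarrow> s \<noteq> [] \<Longrightarrow> lexordp_eq (v :: 'a::linorder list) s" "t \<in> shuffles u v"
  shows "lexordp_eq t (u @ v)"
  using assms
proof (induction u arbitrary: t rule: list.induct)
  case Nil
  then show ?case by (simp add: lexordp_eq_refl)
next
  case (Cons x u)
  have suf: "\<And>s. suffix s u \<Longrightarrow> s \<noteq> [] \<Longrightarrow> lexordp_eq v s"
    by (rule Cons.prems(1)) (auto simp: suffix_Cons)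
  have le: "lexordp_eq v (x # u)" by (rule Cons.prems(1)) auto
  note t = Cons.prems(2)
  show ?case
  proof (cases v)
    case Nil
    then show ?thesis using t lexordp_eq_refl by auto
  next
    case v: (Cons y v')
    with t consider t1 where "t = x # t1" "t1 \<in> shuffles u v"
      | t1 where "t = y # t1" "t1 \<in> shuffles (x # u) v'" by auto
    then show ?thesis
    proof cases
      case 1
      then show ?thesis using Cons.IH[OF suf 1(2)] by simp
    next
      case 2
      show ?thesis
      proof (cases "y < x")
        case True then show ?thesis using 2 by simp
      next
        case False
        with le v have y: "y = x" "lexordp_eq v' u" by auto
        from shuffle_transfer_prefix[OF y(2), of t1 "[x]"] 2 y v
        obtain t' where "t' \<in> shuffles u v" "lexordp_eq t1 t'" by auto
        with Cons.IH[OF suf, of t'] have "lexordp_eq t1 (u @ v)" using lexordp_eq_trans by blast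
        then show ?thesis using 2 y by simp
      qed
    qed
  qed
qed

lemma obtain_lex_min_suffix:
  assumes "S \<noteq> {}" "S \<subseteq> {v. suffix v (w :: 'a::linorder list)}"
  obtains v where "v \<in> S" "\<And>v'. v' \<in> S \<Longrightarrow> lexordp_eq v v'"
proof -
  have "{v. suffix v w} = set (suffixes w)" by (auto simp: in_set_suffixes)
  then have "finite S" using assms(2) finite_subset by (metis List.finite_set)
  then have "S \<noteq> {} \<longrightarrow> (\<exists>v\<in>S. \<forall>v'\<in>S. lexordp_eq v v')"
  proof (induction S rule: finite_induct)
    case (insert a S)
    show ?case
    proof (cases "S = {}")
      case True then show ?thesis by (simp add: lexordp_eq_refl)
    next
      case False
      with insert obtain v where "v \<in> S" "\<forall>v'\<in>S. lexordp_eq v v'" by blast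
      then show ?thesis
        by (metis insert_iff lexordp_eq_linear lexordp_eq_refl lexordp_eq_trans)
    qed
  qed simp
  with assms that show ?thesis by blast
qed

lemma lyndon_iff:
  "lyndon w \<longleftrightarrow> w \<noteq> [] \<and> (\<forall>v. v \<noteq> [] \<and> strict_suffix v w \<longrightarrow> \<not> lexordp_eq v w)"
  unfolding lyndon_def lexord_conv_lexordp by blast

text \<open>
  For a word \<open>v\<close> that is minimal among its own suffixes, \<open>s @ v \<ge> v\<close> forces \<open>s \<ge> v\<close>: otherwise
  \<open>v\<close> is \<open>s\<close> followed by some nonempty \<open>t\<close>, and cancelling \<open>s\<close> gives \<open>v \<ge> t\<close> for a proper suffix \<open>t\<close>.
\<close>

lemma min_suffix_compare:
  assumes min: "\<And>v'. suffix v' v \<Longrightarrow> v' \<noteq> [] \<Longrightarrow> lexordp_eq v v'"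
    and "lexordp_eq v (s @ v)" "s \<noteq> []"
  shows "lexordp_eq v (s :: 'a::linorder list)"
proof (rule ccontr)
  assume n: "\<not> lexordp_eq v s"
  from not_lexordp_eq_append[OF this, of "[]" v] assms(2)
  obtain t where t: "t \<noteq> []" "v = s @ t" by auto
  with assms(2) have "lexordp_eq t v" by (metis lexordp_eq_append_cancel)
  moreover have "lexordp_eq v t" using min t by (simp add: suffixI)
  ultimately have "t = v" by (rule lexordp_eq_antisym)
  then have "length v = length s + length v" using arg_cong[OF t(2), of length] by simp
  with \<open>s \<noteq> []\<close> show False by simp
qed

text \<open>
  The split takes for \<open>v\<close> the smallest nonempty suffix of \<open>w\<close>, the last factor of the
  Chen--Fox--Lyndon factorization. It is proper because \<open>w\<close> is not Lyndon, and minimality makes every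
  nonempty suffix of \<open>u\<close> at least \<open>v\<close>.
\<close>

lemma not_lyndon_split:
  assumes "w \<noteq> []" "\<not> lyndon w"
  obtains u v where "u \<noteq> []" "v \<noteq> []" "w = u @ v" "\<And>t. t \<in> shuffles u v \<Longrightarrow> lexordp_eq t w"
proof -
  obtain v where v: "suffix v w" "v \<noteq> []" and min: "\<And>v'. suffix v' w \<Longrightarrow> v' \<noteq> [] \<Longrightarrow> lexordp_eq v v'"
    by (rule obtain_lex_min_suffix[of "{v. suffix v w \<and> v \<noteq> []}" w]) (use assms in auto)
  obtain u where w: "w = u @ v" using v by (auto simp: suffix_def)
  have "u \<noteq> []"
  proof
    assume "u = []"
    then have "lexordp_eq v' w \<longrightarrow> v' = w" if "suffix v' w" "v' \<noteq> []" for v'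
      using w min[OF that] lexordp_eq_antisym by auto
    then show False using assms by (auto simp: lyndon_iff strict_suffix_def)
  qed
  have "lexordp_eq v s" if s: "suffix s u" "s \<noteq> []" for s
  proof (rule min_suffix_compare)
    show "lexordp_eq v v'" if "suffix v' v" "v' \<noteq> []" for v'
      using min that v suffix_order.trans by blast
    show "lexordp_eq v (s @ v)" using min s w by (auto simp: suffix_def)
  qed (use s in simp)
  then have "lexordp_eq t w" if "t \<in> shuffles u v" for t
    using shuffles_le_append[OF _ that] w by blast
  then show ?thesis using that v(2) \<open>u \<noteq> []\<close> w by blast
qed

text \<open>
  Cutting off the smallest proper suffix \<open>v\<close> leaves two Lyndon words. For \<open>v\<close> this is immediate. A
  proper suffix \<open>s < u\<close> of the rest \<open>u\<close> either yields the suffix \<open>s @ v < w\<close> of \<open>w\<close>, or is a prefix of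
  \<open>u = s @ t\<close>, and then the suffix \<open>t @ v\<close> of \<open>w\<close> is smaller than \<open>v\<close>;
  the former contradicts that \<open>w\<close> is Lyndon, the latter the choice of \<open>v\<close>.
\<close>

lemma lyndon_splits_nonempty:
  assumes "lyndon w" "length w \<ge> 2"
  shows "lyndon_splits w \<noteq> {}"
proof -
  let ?S = "{v. strict_suffix v w \<and> v \<noteq> []}"
  have "drop 1 w \<in> ?S" using assms(2) 
    by (auto simp: strict_suffix_def suffix_drop dest: arg_cong[of _ w length])
  then obtain v where v: "strict_suffix v w" "v \<noteq> []"
    and min: "\<And>v'. strict_suffix v' w \<Longrightarrow> v' \<noteq> [] \<Longrightarrow> lexordp_eq v v'"
    by - (rule obtain_lex_min_suffix[of ?S w], auto simp: strict_suffix_def)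
  then obtain u where w: "w = u @ v" "u \<noteq> []" by (auto simp: strict_suffix_def suffix_def)
  have minv: "lexordp_eq v v'" if "suffix v' v" "v' \<noteq> []" for v'
    using min that v suffix_order.le_less_trans by blast
  have "lyndon v" unfolding lyndon_iff
    using v minv lexordp_eq_antisym by (blast dest: suffix_order.less_imp_le)
  moreover have "lyndon u" unfolding lyndon_iff
  proof (intro conjI allI impI notI)
    show "u = [] \<Longrightarrow> False" using w by simp
    fix s assume s: "s \<noteq> [] \<and> strict_suffix s u" and le: "lexordp_eq s u"
    have sv: "strict_suffix (s @ v) w" using s w by (auto simp: strict_suffix_def suffix_def)
    with assms s have gt: "\<not> lexordp_eq (s @ v) (u @ v)" unfolding lyndon_iff using w by auto
    have "\<not> lexordp_eq u s" using le s lexordp_eq_antisym by (auto simp: strict_suffix_def)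
    show False
    proof (cases "\<exists>t. t \<noteq> [] \<and> u = s @ t")
      case True
      then obtain t where t: "t \<noteq> []" "u = s @ t" by blast
      with gt have "\<not> lexordp_eq v (t @ v)" by simp
      moreover have "strict_suffix (t @ v) w" using t w s by (auto simp: strict_suffix_def suffix_def)
      ultimately show False using min t by simp
    next
      case False
      with not_lexordp_eq_append[of u s v v] \<open>\<not> lexordp_eq u s\<close> gt
        lexordp_eq_linear[of "u @ v" "s @ v"] show False by blast
    qed
  qed
  ultimately have "length u \<in> lyndon_splits w" using w v by (simp add: lyndon_splits_def)
  then show ?thesis by blast
qed

text \<open>
  The basis is numbered by the order \<open>\<le>\<close> on lists, which compares lengths first, whereas Lyndon words
  and shuffles are governed by the lexicographic order. All words compared below have equal length.
\<close>

lemma less_eq_list_same_length: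
  assumes "length u = length (v :: 'a::linorder list)"
  shows "u \<le> v \<longleftrightarrow> lexordp_eq u v"
proof -
  have "u < v \<longleftrightarrow> (u, v) \<in> lexord {(a, b). a < b}"
    using assms by (simp add: list_less_def lenlex_conv lexord_lex)
  then show ?thesis
    unfolding list_le_def lexord_conv_lexordp
    using lexordp_eq_linear[of u v] lexordp_eq_refl[of u] lexordp_eq_antisym[of u v] by blast
qed

lemma less_list_length: "length u < length v \<Longrightarrow> u < (v :: 'a::linorder list)"
  by (simp add: list_less_def lenlex_conv)

lemma less_eq_list_length: "u \<le> (v :: 'a::linorder list) \<Longrightarrow> length u \<le> length v"
  using less_list_length leD by (meson not_le_imp_less)


section \<open>The truncated tensor algebra\<close>

lemma tens_mult_long [simp]: "length v > L \<Longrightarrow> tens_mult L f g v = 0"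
  by (simp add: tens_mult_def)

text \<open>
  Multiplication respects the filtration by length; this lemma and the two congruences for powers
  record which part of the arguments a coefficient can depend on.
\<close>

lemma tens_mult_cong_le:
  assumes "\<And>u. length u \<le> length v \<Longrightarrow> f u = f' u" "\<And>u. length u \<le> length v \<Longrightarrow> g u = g' u"
  shows "tens_mult L f g v = tens_mult L f' g' v"
  unfolding tens_mult_def by (auto intro!: sum.cong simp: assms)

lemma tens_mult_assoc:
  "tens_mult L (tens_mult L f g) h = tens_mult L f (tens_mult L g h)"
proof
  fix v :: "nat list"
  show "tens_mult L (tens_mult L f g) h v = tens_mult L f (tens_mult L g h) v"
  proof (cases "length v \<le> L")
    case True
    let ?n = "length v"
    let ?t = "\<lambda>i j. f (take i v) * g (take j (drop i v)) * h (drop (i + j) v)"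
    have "tens_mult L (tens_mult L f g) h v = (\<Sum>k\<le>?n. \<Sum>i\<le>k. ?t i (k - i))"
      using True by (auto simp: tens_mult_def sum_distrib_right min_def drop_take intro!: sum.cong)
    also have "\<dots> = (\<Sum>(i, j)\<in>{(i, j). i + j \<le> ?n}. ?t i j)"
      by (rule sum.triangle_reindex_eq[symmetric])
    also have "{(i, j). i + j \<le> ?n} = (SIGMA i:{..?n}. {..?n - i})" by auto
    also have "(\<Sum>(i, j)\<in>\<dots>. ?t i j) = (\<Sum>i\<le>?n. \<Sum>j\<le>?n - i. ?t i j)"
      by (rule sum.Sigma[symmetric]) auto
    also have "\<dots> = tens_mult L f (tens_mult L g h) v"
      using True
      by (auto simp: tens_mult_def sum_distrib_left mult.assoc add.commute intro!: sum.cong)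
    finally show ?thesis .
  qed simp
qed

lemma tens_mult_one_right:
  assumes "length v \<le> L"
  shows "tens_mult L f (tens_word []) v = f v"
proof -
  have "(\<Sum>k\<le>length v. f (take k v) * tens_word [] (drop k v)) =
      (\<Sum>k\<in>{length v}. f (take k v) * tens_word [] (drop k v))"
    by (rule sum.mono_neutral_right) (auto simp: tens_word_def)
  then show ?thesis using assms by (simp add: tens_mult_def tens_word_def)
qed

lemma tens_mult_one_left:
  assumes "length v \<le> L"
  shows "tens_mult L (tens_word []) f v = f v"
proof -
  have "(\<Sum>k\<le>length v. tens_word [] (take k v) * f (drop k v)) =
      (\<Sum>k\<in>{0}. tens_word [] (take k v) * f (drop k v))"
    by (rule sum.mono_neutral_right) (auto simp: tens_word_def)
  then show ?thesis using assms by (simp add: tens_mult_def tens_word_def)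
qed

lemma tens_mult_sum_scaleR:
  fixes f g :: "nat \<Rightarrow> 'a::{comm_ring_1, real_algebra_1} tens"
  shows "tens_mult L (\<lambda>v. \<Sum>i\<in>I. a i *\<^sub>R f i v) (\<lambda>v. \<Sum>j\<in>J. b j *\<^sub>R g j v) v =
    (\<Sum>i\<in>I. \<Sum>j\<in>J. (a i * b j) *\<^sub>R tens_mult L (f i) (g j) v)"
proof (cases "length v \<le> L")
  case True
  have "(\<Sum>k\<le>length v. (\<Sum>i\<in>I. a i *\<^sub>R f i (take k v)) * (\<Sum>j\<in>J. b j *\<^sub>R g j (drop k v))) =
      (\<Sum>k\<le>length v. \<Sum>i\<in>I. \<Sum>j\<in>J. (a i * b j) *\<^sub>R (f i (take k v) * g j (drop k v)))"
    by (simp add: sum_product mult.commute)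
  also have "\<dots> = (\<Sum>i\<in>I. \<Sum>k\<le>length v. \<Sum>j\<in>J. (a i * b j) *\<^sub>R (f i (take k v) * g j (drop k v)))"
    by (rule sum.swap)
  also have "\<dots> = (\<Sum>i\<in>I. \<Sum>j\<in>J. \<Sum>k\<le>length v. (a i * b j) *\<^sub>R (f i (take k v) * g j (drop k v)))"
    by (intro sum.cong refl sum.swap)
  finally show ?thesis using True by (simp add: tens_mult_def scaleR_sum_right)
qed simp

lemma tens_pow_long [simp]: "length v > L \<Longrightarrow> tens_pow L f k v = 0"
  by (cases k) (auto simp: tens_word_def)

lemma tens_pow_nilpotent:
  assumes "f [] = 0" "k > length v"
  shows "tens_pow L f k v = 0"
  using assms(2)
proof (induction k arbitrary: v)
  case (Suc k)
  have "f (take i v) * tens_pow L f k (drop i v) = 0" if "i \<le> length v" for i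
    using Suc that assms(1) by (cases "i = 0") auto
  then show ?case by (simp add: tens_mult_def)
qed simp

lemma tens_pow_eq_0:
  assumes "f [] = 0" "k > L"
  shows "tens_pow L f k v = 0"
  using assms by (cases "length v > L") (auto intro: tens_pow_nilpotent)

lemma tens_pow_add: "tens_mult L (tens_pow L f i) (tens_pow L f j) = tens_pow L f (i + j)"
proof (induction i)
  case 0
  show ?case
  proof
    fix v show "tens_mult L (tens_pow L f 0) (tens_pow L f j) v = tens_pow L f (0 + j) v"
      by (cases "length v \<le> L") (auto simp: tens_mult_one_left)
  qed
qed (simp add: tens_mult_assoc)

lemma tens_pow_cong_le:
  assumes "\<And>u. length u \<le> length v \<Longrightarrow> f u = f' u"
  shows "tens_pow L f k v = tens_pow L f' k v"
  using assms
proof (induction k arbitrary: v)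
  case (Suc k)
  show ?case unfolding tens_pow.simps
    by (rule tens_mult_cong_le) (use Suc in auto)
qed simp

text \<open>
  A product of at least two factors without constant term distributes a word of length \<open>n\<close> over
  factors of length below \<open>n\<close>. For \<open>k = 0\<close> the power does not depend on \<open>f\<close> at all.
\<close>

lemma tens_pow_cong_less:
  assumes "f [] = 0" "f' [] = 0" "\<And>u. length u < length v \<Longrightarrow> f u = f' u" "k \<noteq> 1"
  shows "tens_pow L f k v = tens_pow L f' k v"
proof (cases k)
  case (Suc k')
  with assms(4) have k': "k' > 0" by simp
  have "f (take i v) * tens_pow L f k' (drop i v) = f' (take i v) * tens_pow L f' k' (drop i v)"
    if i: "i \<le> length v" for i
  proof -
    consider "i = 0" | "i = length v" | "0 < i" "i < length v" using i by linarith
    then show ?thesis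
    proof cases
      case 1 then show ?thesis using assms by simp
    next
      case 2 then show ?thesis using assms k' by (simp add: tens_pow_nilpotent)
    next
      case 3 
      then have "tens_pow L f k' (drop i v) = tens_pow L f' k' (drop i v)"
        using assms(3) by (intro tens_pow_cong_le) auto
      then show ?thesis using assms(3) 3 by simp
    qed
  qed
  then show ?thesis using Suc by (simp add: tens_mult_def)
qed simp

section \<open>Power series in a nilpotent tensor\<close>

text \<open>
  Substitution of \<open>f\<close> into a formal power series. It is multiplicative and compatible with composition,
  so identities between \<open>exp\<close> and \<open>log\<close> of tensors reduce to identities of real power series.
\<close>

definition tens_series :: "nat \<Rightarrow> real fps \<Rightarrow> 'a::{comm_ring_1, real_algebra_1} tens \<Rightarrow> 'a tens" where
  "tens_series L F f = (\<lambda>v. \<Sum>k\<le>L. (F $ k) *\<^sub>R tens_pow L f k v)"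

lemma tens_series_long [simp]: "length v > L \<Longrightarrow> tens_series L F f v = 0"
  by (simp add: tens_series_def)

lemma tens_series_Nil: "f [] = 0 \<Longrightarrow> tens_series L F f [] = (F $ 0) *\<^sub>R 1"
proof -
  assume f: "f [] = 0"
  have "(\<Sum>k\<le>L. (F $ k) *\<^sub>R tens_pow L f k []) = (\<Sum>k\<in>{0}. (F $ k) *\<^sub>R tens_pow L f k [])"
    by (rule sum.mono_neutral_right) (auto simp: tens_pow_nilpotent f)
  then show ?thesis by (simp add: tens_series_def tens_word_def)
qed

lemma tens_series_cong_le:
  "(\<And>u. length u \<le> length v \<Longrightarrow> f u = f' u) \<Longrightarrow> tens_series L F f v = tens_series L F f' v"
  unfolding tens_series_def by (intro sum.cong refl arg_cong2[where f = scaleR] tens_pow_cong_le) auto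

lemma tens_series_one: "tens_series L 1 f = tens_word []"
proof
  fix v
  have "(\<Sum>k\<le>L. ((1 :: real fps) $ k) *\<^sub>R tens_pow L f k v) = (\<Sum>k\<in>{0}. ((1 :: real fps) $ k) *\<^sub>R tens_pow L f k v)"
    by (rule sum.mono_neutral_right) auto
  then show "tens_series L 1 f v = tens_word [] v" by (simp add: tens_series_def)
qed

lemma tens_series_X:
  assumes "f [] = 0" "length v \<le> L"
  shows "tens_series L fps_X f v = f v"
proof (cases "L = 0")
  case True
  then show ?thesis using assms by (simp add: tens_series_def)
next
  case False
  have "(\<Sum>k\<le>L. ((fps_X :: real fps) $ k) *\<^sub>R tens_pow L f k v)
      = (\<Sum>k\<in>{1}. ((fps_X :: real fps) $ k) *\<^sub>R tens_pow L f k v)"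
    by (rule sum.mono_neutral_right) (use False in auto)
  then show ?thesis using assms by (simp add: tens_series_def tens_mult_one_right)
qed

lemma tens_series_add: "tens_series L (F + G) f v = tens_series L F f v + tens_series L G f v"
  by (simp add: tens_series_def scaleR_add_left sum.distrib)

text \<open>
  Double sums over nilpotent powers may be regrouped by total degree, as \<open>t i j\<close> vanishes outside the
  triangle.
\<close>

lemma sum_product_triangle:
  fixes L :: nat
  assumes "\<And>i j. i \<le> L \<Longrightarrow> j \<le> L \<Longrightarrow> i + j > L \<Longrightarrow> t i j = (0 :: 'a::comm_monoid_add)"
  shows "(\<Sum>i\<le>L. \<Sum>j\<le>L. t i j) = (\<Sum>n\<le>L. \<Sum>i\<le>n. t i (n - i))"
proof -
  have "(\<Sum>i\<le>L. \<Sum>j\<le>L. t i j) = (\<Sum>(i, j)\<in>{..L} \<times> {..L}. t i j)" by (rule sum.cartesian_product)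
  also have "\<dots> = (\<Sum>(i, j)\<in>{(i, j). i + j \<le> L}. t i j)"
  proof (rule sum.mono_neutral_right)
    have "(case p of (i, j) \<Rightarrow> t i j) = 0" if p: "p \<in> {..L} \<times> {..L} - {(i, j). i + j \<le> L}" for p
    proof -
      obtain i j where "p = (i, j)" by (cases p)
      with p show ?thesis using assms[of i j] by simp
    qed
    then show "\<forall>p\<in>{..L} \<times> {..L} - {(i, j). i + j \<le> L}. (case p of (i, j) \<Rightarrow> t i j) = 0" ..
  qed auto
  also have "\<dots> = (\<Sum>n\<le>L. \<Sum>i\<le>n. t i (n - i))" by (rule sum.triangle_reindex_eq)
  finally show ?thesis .
qed

lemma tens_series_mult:
  assumes "f [] = 0"
  shows "tens_mult L (tens_series L F f) (tens_series L G f) = tens_series L (F * G) f"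
proof
  fix v
  have "tens_mult L (tens_series L F f) (tens_series L G f) v =
      (\<Sum>i\<le>L. \<Sum>j\<le>L. (F $ i * G $ j) *\<^sub>R tens_pow L f (i + j) v)"
    unfolding tens_series_def tens_mult_sum_scaleR tens_pow_add ..
  also have "\<dots> = (\<Sum>n\<le>L. \<Sum>i\<le>n. (F $ i * G $ (n - i)) *\<^sub>R tens_pow L f (i + (n - i)) v)"
    by (rule sum_product_triangle) (simp add: tens_pow_eq_0 assms)
  also have "\<dots> = tens_series L (F * G) f v"
    by (simp add: tens_series_def fps_mult_nth scaleR_sum_left atMost_atLeast0)
  finally show "tens_mult L (tens_series L F f) (tens_series L G f) v = tens_series L (F * G) f v" .
qed

lemma tens_pow_series:
  assumes "f [] = 0"
  shows "tens_pow L (tens_series L G f) k = tens_series L (G ^ k) f"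
  by (induction k) (auto simp: tens_series_one tens_series_mult assms)

lemma tens_series_compose:
  assumes "f [] = 0" "G $ 0 = 0"
  shows "tens_series L F (tens_series L G f) = tens_series L (F oo G) f"
proof
  fix v
  have "tens_series L F (tens_series L G f) v =
      (\<Sum>k\<le>L. \<Sum>m\<le>L. ((F $ k) * (G ^ k) $ m) *\<^sub>R tens_pow L f m v)"
    unfolding tens_series_def[of L F] tens_pow_series[where f = f, OF assms(1)]
    by (simp add: tens_series_def scaleR_sum_right)
  also have "\<dots> = (\<Sum>m\<le>L. \<Sum>k\<le>L. ((F $ k) * (G ^ k) $ m) *\<^sub>R tens_pow L f m v)"
    by (rule sum.swap)
  also have "\<dots> = (\<Sum>m\<le>L. \<Sum>k\<le>m. ((F $ k) * (G ^ k) $ m) *\<^sub>R tens_pow L f m v)"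
    by (intro sum.cong refl sum.mono_neutral_right)
       (auto simp: startsby_zero_power_prefix[OF assms(2), rule_format])
  also have "\<dots> = tens_series L (F oo G) f v"
    by (simp add: tens_series_def fps_compose_nth scaleR_sum_left atMost_atLeast0)
  finally show "tens_series L F (tens_series L G f) v = tens_series L (F oo G) f v" .
qed

text \<open>
  Only the linear term of the series sees the part of \<open>f\<close> of full length.
\<close>

lemma tens_series_cong_less:
  assumes "f [] = 0" "f' [] = 0" "\<And>u. length u < length v \<Longrightarrow> f u = f' u" "length v \<le> L"
  shows "tens_series L F f v - (F $ 1) *\<^sub>R f v = tens_series L F f' v - (F $ 1) *\<^sub>R f' v"
proof (cases "v = []")
  case False
  with assms(4) have L: "1 \<le> L" by (cases v) auto
  have "tens_series L F g v - (F $ 1) *\<^sub>R g v = (\<Sum>k\<in>{..L} - {1}. (F $ k) *\<^sub>R tens_pow L g k v)" 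
    if "g [] = 0" for g :: "'a tens"
    using L assms(4) that unfolding tens_series_def
    by (subst sum.remove[of _ 1]) (auto simp: tens_mult_one_right)
  moreover have "(\<Sum>k\<in>{..L} - {1}. (F $ k) *\<^sub>R tens_pow L f k v) = (\<Sum>k\<in>{..L} - {1}. (F $ k) *\<^sub>R tens_pow L f' k v)"
    by (intro sum.cong refl arg_cong2[where f = scaleR] tens_pow_cong_less) (use assms in auto)
  ultimately show ?thesis using assms by simp
qed (use assms in \<open>simp add: tens_series_Nil\<close>)

lemma tens_exp_eq_series: "tens_exp L f = tens_series L (fps_exp 1) f"
  by (simp add: tens_exp_def tens_series_def)

lemma tens_log_eq_series: "tens_log L g = tens_series L (fps_ln 1) (\<lambda>u. g u - tens_word [] u)"
proof
  fix v
  have "tens_log L g v = (\<Sum>k=1..L. (fps_ln 1 $ k) *\<^sub>R tens_pow L (\<lambda>u. g u - tens_word [] u) k v)"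
    unfolding tens_log_def
  proof (intro sum.cong refl)
    fix k assume "k \<in> {1..L}"
    then obtain k' where "k = Suc k'" by (cases k) auto
    then show "((-1) ^ (k + 1) / real k) *\<^sub>R tens_pow L (\<lambda>u. g u - tens_word [] u) k v =
        (fps_ln 1 $ k) *\<^sub>R tens_pow L (\<lambda>u. g u - tens_word [] u) k v"
      by (simp add: fps_ln_nth)
  qed
  also have "\<dots> = (\<Sum>k\<le>L. (fps_ln 1 $ k) *\<^sub>R tens_pow L (\<lambda>u. g u - tens_word [] u) k v)"
    by (rule sum.mono_neutral_left) (auto simp: not_le)
  finally show "tens_log L g v = tens_series L (fps_ln 1) (\<lambda>u. g u - tens_word [] u) v"
    by (simp add: tens_series_def)
qed

lemma fps_exp_compose_ln: "fps_exp 1 oo fps_ln 1 = 1 + (fps_X :: real fps)"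
proof -
  have "(fps_exp (1::real) - 1) oo fps_ln 1 = fps_X"
    by (simp add: fps_ln_fps_exp_inv fps_inv_fps_exp_compose)
  then show ?thesis by (simp add: fps_compose_sub_distrib algebra_simps)
qed

lemma tens_exp_log:
  assumes "g [] = 1" "length v \<le> L"
  shows "tens_exp L (tens_log L g) v = g v"
proof -
  have "tens_exp L (tens_log L g) = tens_series L (1 + fps_X) (\<lambda>u. g u - tens_word [] u)"
    unfolding tens_exp_eq_series tens_log_eq_series
    by (subst tens_series_compose) (use assms in \<open>auto simp: tens_word_def fps_exp_compose_ln\<close>)
  then show ?thesis
    using assms by (simp add: tens_series_add tens_series_one tens_series_X tens_word_def)
qed

lemma tens_exp_Nil [simp]: "f [] = 0 \<Longrightarrow> tens_exp L f [] = 1"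
  by (simp add: tens_exp_eq_series tens_series_Nil)

lemma tens_log_Nil [simp]: "g [] = 1 \<Longrightarrow> tens_log L g [] = 0"
  by (simp add: tens_log_eq_series tens_series_Nil tens_word_def)

lemma tens_exp_uminus:
  "tens_exp L (\<lambda>v. - f v) = tens_series L (fps_exp (-1)) (f :: 'a::{comm_ring_1, real_algebra_1} tens)"
proof -
  have "tens_pow L (\<lambda>v. - f v) k v = (-1) ^ k * tens_pow L f k v" for k v
    by (induction k arbitrary: v) (auto simp: tens_mult_def sum_distrib_left sum_negf[symmetric] algebra_simps)
  moreover have "(-1) ^ k * x = (-1::real) ^ k *\<^sub>R x" for k and x :: 'a
    by (induction k) auto
  ultimately show ?thesis by (simp add: tens_exp_def tens_series_def)
qed

lemma tens_exp_inverse: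
  assumes "f [] = 0"
  shows "tens_mult L (tens_exp L (\<lambda>v. - f v)) (tens_exp L f) = tens_word []"
    and "tens_mult L (tens_exp L f) (tens_exp L (\<lambda>v. - f v)) = tens_word []"
  unfolding tens_exp_uminus tens_exp_eq_series tens_series_mult[where f = f, OF assms]
  by (simp_all add: fps_exp_add_mult[symmetric] tens_series_one)


section \<open>The shuffle coproduct\<close>

text \<open>
  The shuffles of two words listed with multiplicity, in contrast to \<^const>\<open>shuffles\<close>, which forms a set.
\<close>

fun shuffle_list :: "'a list \<Rightarrow> 'a list \<Rightarrow> 'a list list" where
  "shuffle_list [] v = [v]"
| "shuffle_list u [] = [u]"
| "shuffle_list (x # u) (y # v) =
     map ((#) x) (shuffle_list u (y # v)) @ map ((#) y) (shuffle_list (x # u) v)"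

lemma shuffle_list_Nil_right [simp]: "shuffle_list u [] = [u]"
  by (cases u) auto

lemma set_shuffle_list: "set (shuffle_list u v) = shuffles u v"
  by (induction u v rule: shuffle_list.induct) auto

text \<open>
  The coproduct dual to the shuffle product: the pairing of \<open>f\<close> with the shuffle of \<open>u\<close> and \<open>v\<close>.
\<close>

definition coprod :: "'a::comm_ring_1 tens \<Rightarrow> nat list \<Rightarrow> nat list \<Rightarrow> 'a" where
  "coprod f u v = (\<Sum>t\<leftarrow>shuffle_list u v. f t)"

lemma coprod_Nil [simp]: "coprod f [] v = f v" "coprod f u [] = f u"
  by (simp_all add: coprod_def)

lemma coprod_Cons:
  "coprod f (x # u) (y # v) = coprod (\<lambda>t. f (x # t)) u (y # v) + coprod (\<lambda>t. f (y # t)) (x # u) v"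
  by (simp add: coprod_def comp_def)

lemma coprod_cong:
  "(\<And>t. t \<in> shuffles u v \<Longrightarrow> f t = g t) \<Longrightarrow> coprod f u v = coprod g u v"
  unfolding coprod_def set_shuffle_list[symmetric]
  by (metis (no_types, lifting) map_eq_conv)

lemma coprod_cong_length:
  "(\<And>t. length t = length u + length v \<Longrightarrow> f t = g t) \<Longrightarrow> coprod f u v = coprod g u v"
  by (rule coprod_cong) (auto dest: length_shuffles)

lemma coprod_add: "coprod (\<lambda>t. f t + g t) u v = coprod f u v + coprod g u v"
  by (simp add: coprod_def sum_list_addf)

lemma coprod_diff: "coprod (\<lambda>t. f t - g t) u v = coprod f u v - coprod g u v"
  by (simp add: coprod_def sum_list_subtractf)

lemma coprod_mult_left: "coprod (\<lambda>t. c * f t) u v = c * coprod f u v"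
  by (simp add: coprod_def sum_list_const_mult)

lemma coprod_scaleR:
  "coprod (\<lambda>t. c *\<^sub>R f t) u v = c *\<^sub>R coprod (f :: 'a::{comm_ring_1, real_algebra_1} tens) u v"
proof -
  have "(\<Sum>t\<leftarrow>ts. c *\<^sub>R f t) = c *\<^sub>R (\<Sum>t\<leftarrow>ts. f t)" for ts
    by (induction ts) (auto simp: scaleR_add_right)
  then show ?thesis by (simp add: coprod_def)
qed

lemma coprod_zero [simp]: "coprod (\<lambda>t. 0) u v = 0"
  by (simp add: coprod_def)

lemma coprod_sum: "coprod (\<lambda>t. \<Sum>k\<in>K. f k t) u v = (\<Sum>k\<in>K. coprod (f k) u v)"
  by (induction K rule: infinite_finite_induct) (auto simp: coprod_add)

lemma coprod_one: "coprod (tens_word []) u v = tens_word [] u * tens_word [] v"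
proof (cases "u = [] \<or> v = []")
  case False
  then have "coprod (tens_word [] :: 'a tens) u v = coprod (\<lambda>t. 0) u v"
    by (intro coprod_cong) (auto simp: tens_word_def)
  then show ?thesis using False by (simp add: tens_word_def)
qed (auto simp: tens_word_def)

text \<open>
  The form in which orthogonality to shuffles is exploited: where \<open>w\<close> is the only shuffle in the support
  of \<open>f\<close>, the pairing is a positive multiple of \<open>f w\<close>.
\<close>

lemma coprod_eq_multiple:
  assumes "\<And>t. t \<in> shuffles u v \<Longrightarrow> t \<noteq> w \<Longrightarrow> f t = 0" "w \<in> shuffles u v"
  shows "\<exists>n::nat. n > 0 \<and> coprod f u v = of_nat n * f w"
proof -
  have "coprod f u v = of_nat (count_list ts w) * f w"
    if "\<And>t. t \<in> set ts \<Longrightarrow> t \<noteq> w \<Longrightarrow> f t = 0" "coprod f u v = (\<Sum>t\<leftarrow>ts. f t)" for ts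
  proof -
    have "(\<Sum>t\<leftarrow>ts. f t) = of_nat (count_list ts w) * f w" using that(1)
      by (induction ts) (auto simp: algebra_simps)
    with that(2) show ?thesis by simp
  qed
  from this[of "shuffle_list u v"] assms
  have "coprod f u v = of_nat (count_list (shuffle_list u v) w) * f w"
    by (simp add: set_shuffle_list coprod_def)
  moreover have "count_list (shuffle_list u v) w > 0"
    using assms(2) by (metis count_list_0_iff gr0I set_shuffle_list)
  ultimately show ?thesis by blast
qed

lemma tens_mult_Cons:
  "length t \<le> L \<Longrightarrow> tens_mult (Suc L) f g (x # t) = f [] * g (x # t) + tens_mult L (\<lambda>t. f (x # t)) g t"
  by (simp add: tens_mult_def sum.atMost_Suc_shift del: sum.atMost_Suc)

text \<open>
  Deconcatenation and shuffling form a bialgebra. The induction strips the first letter of a shuffle: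
  the left derivative \<open>\<lambda>t. f (x # t)\<close> turns the product into \<open>f []\<close> times the derivative of \<open>g\<close>, plus a
  product with truncation one lower, and the two recursive sums fill up all cuts of \<open>u\<close> and \<open>v\<close>
  except the trivial one.
\<close>

theorem coprod_mult:
  assumes "length u + length v \<le> L"
  shows "coprod (tens_mult L f g) u v =
    (\<Sum>i\<le>length u. \<Sum>j\<le>length v. coprod f (take i u) (take j v) * coprod g (drop i u) (drop j v))"
  using assms
proof (induction u v arbitrary: f g L rule: shuffle_list.induct)
  case (3 x u y v)
  then obtain L' where L: "L = Suc L'" "length u + length (y # v) \<le> L'" "length (x # u) + length v \<le> L'"
    by (cases L) auto
  have 1: "coprod (\<lambda>t. tens_mult L f g (x # t)) u (y # v) =
      f [] * coprod (\<lambda>t. g (x # t)) u (y # v) + coprod (tens_mult L' (\<lambda>t. f (x # t)) g) u (y # v)"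
    unfolding coprod_mult_left[symmetric] coprod_add[symmetric]
    by (rule coprod_cong_length) (use L in \<open>auto simp: tens_mult_Cons\<close>)
  have 2: "coprod (\<lambda>t. tens_mult L f g (y # t)) (x # u) v =
      f [] * coprod (\<lambda>t. g (y # t)) (x # u) v + coprod (tens_mult L' (\<lambda>t. f (y # t)) g) (x # u) v"
    unfolding coprod_mult_left[symmetric] coprod_add[symmetric]
    by (rule coprod_cong_length) (use L in \<open>auto simp: tens_mult_Cons\<close>)
  show ?case
    unfolding coprod_Cons[of "tens_mult L f g"] 1 2
      "3.IH"(1)[OF L(2)] "3.IH"(2)[OF L(3)]
    by (simp add: sum.atMost_Suc_shift coprod_Cons distrib_right distrib_left sum.distrib
        ac_simps del: sum.atMost_Suc)
qed (auto simp: tens_mult_def)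

section \<open>Primitive and group-like tensors\<close>

definition primitive :: "'a::comm_ring_1 tens \<Rightarrow> bool" where
  "primitive f \<longleftrightarrow> f [] = 0 \<and> (\<forall>u v. u \<noteq> [] \<longrightarrow> v \<noteq> [] \<longrightarrow> coprod f u v = 0)"

definition grouplike :: "nat \<Rightarrow> 'a::comm_ring_1 tens \<Rightarrow> bool" where
  "grouplike L g \<longleftrightarrow>
     g [] = 1 \<and> (\<forall>u v. length u + length v \<le> L \<longrightarrow> coprod g u v = g u * g v)"

lemma primitive_Nil: "primitive f \<Longrightarrow> f [] = 0"
  by (simp add: primitive_def)

lemma primitive_add: "primitive f \<Longrightarrow> primitive g \<Longrightarrow> primitive (\<lambda>v. f v + g v)"
  and primitive_diff: "primitive f \<Longrightarrow> primitive g \<Longrightarrow> primitive (\<lambda>v. f v - g v)"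
  and primitive_mult_left: "primitive f \<Longrightarrow> primitive (\<lambda>v. a * f v)"
  by (simp_all add: primitive_def coprod_add coprod_diff coprod_mult_left)

lemma primitive_zero [simp]: "primitive (\<lambda>v. 0)"
  by (simp add: primitive_def)

lemma primitive_sum: "(\<And>k. k \<in> K \<Longrightarrow> primitive (f k)) \<Longrightarrow> primitive (\<lambda>v. \<Sum>k\<in>K. f k v)"
  by (induction K rule: infinite_finite_induct) (auto simp: primitive_add)

lemma primitive_letter: "primitive (tens_word [i])"
proof -
  have "coprod (tens_word [i] :: 'a tens) u v = coprod (\<lambda>t. 0) u v" if "u \<noteq> []" "v \<noteq> []" for u v
    using that by (intro coprod_cong_length) (cases u; cases v; auto simp: tens_word_def)
  then show ?thesis by (simp add: primitive_def tens_word_def)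
qed

text \<open>
  A primitive left factor leaves only the cuts that take a prefix of \<open>u\<close> alone or a prefix of \<open>v\<close> alone:
  multiplication by \<open>f\<close> becomes a derivation of the coproduct.
\<close>

lemma coprod_mult_primitive:
  assumes "primitive f" "length u + length v \<le> L"
  shows "coprod (tens_mult L f g) u v =
    (\<Sum>i\<le>length u. f (take i u) * coprod g (drop i u) v) +
    (\<Sum>j\<le>length v. f (take j v) * coprod g u (drop j v))"
proof -
  have "coprod f (take i u) (take j v) =
      (if j = 0 then f (take i u) else 0) + (if i = 0 then f (take j v) else 0)"
    if "i \<le> length u" "j \<le> length v" for i j
  proof (cases "i = 0 \<or> j = 0")
    case False
    with that have "take i u \<noteq> []" "take j v \<noteq> []" by auto
    then show ?thesis using False assms(1) by (simp add: primitive_def)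
  qed (use assms(1) in \<open>auto simp: primitive_def\<close>)
  then have "coprod (tens_mult L f g) u v = (\<Sum>i\<le>length u. \<Sum>j\<le>length v.
      (if j = 0 then f (take i u) * coprod g (drop i u) (drop j v) else 0) +
      (if i = 0 then f (take j v) * coprod g (drop i u) (drop j v) else 0))"
    unfolding coprod_mult[OF assms(2)] by (intro sum.cong refl) (auto simp: distrib_right)
  also have "\<dots> = (\<Sum>i\<le>length u. \<Sum>j\<le>length v. if j = 0 then f (take i u) * coprod g (drop i u) (drop j v) else 0) +
      (\<Sum>j\<le>length v. \<Sum>i\<le>length u. if i = 0 then f (take j v) * coprod g (drop i u) (drop j v) else 0)"
    unfolding sum.distrib by (subst (2) sum.swap) (rule refl)
  finally show ?thesis by (simp add: sum.delta)
qed

text \<open>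
  The right-hand side is symmetric in \<open>f\<close> and \<open>g\<close>, which is why it cancels in the bracket.
\<close>

lemma coprod_mult_primitive2:
  assumes "primitive f" "primitive g" "length u + length v \<le> L" "u \<noteq> []" "v \<noteq> []"
  shows "coprod (tens_mult L f g) u v = f u * g v + f v * g u"
proof -
  have "(\<Sum>i\<le>length u. f (take i u) * coprod g (drop i u) v) =
      (\<Sum>i\<in>{length u}. f (take i u) * coprod g (drop i u) v)"
    by (rule sum.mono_neutral_right) (use assms in \<open>auto simp: primitive_def\<close>)
  moreover have "(\<Sum>j\<le>length v. f (take j v) * coprod g u (drop j v)) =
      (\<Sum>j\<in>{length v}. f (take j v) * coprod g u (drop j v))"
    by (rule sum.mono_neutral_right) (use assms in \<open>auto simp: primitive_def\<close>)
  ultimately show ?thesis using assms by (simp add: coprod_mult_primitive)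
qed

lemma primitive_bracket:
  assumes "primitive f" "primitive g"
  shows "primitive (tens_bracket L f g)"
  unfolding primitive_def
proof (intro conjI allI impI)
  show "tens_bracket L f g [] = 0"
    using assms by (simp add: tens_bracket_def tens_mult_def primitive_Nil)
  fix u v :: "nat list"
  assume "u \<noteq> []" "v \<noteq> []"
  show "coprod (tens_bracket L f g) u v = 0"
  proof (cases "length u + length v \<le> L")
    case True
    then show ?thesis
      unfolding tens_bracket_def coprod_diff
      using assms \<open>u \<noteq> []\<close> \<open>v \<noteq> []\<close> by (simp add: coprod_mult_primitive2 ac_simps)
  next
    case False
    then have "coprod (tens_bracket L f g) u v = coprod (\<lambda>t. 0) u v"
      by (intro coprod_cong_length) (simp add: tens_bracket_def)
    then show ?thesis by simp
  qed
qed

text \<open>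
  The step from \<open>n\<close> to \<open>n + 1\<close> in the binomial theorem, for two sequences that need not be powers of
  ring elements.
\<close>

lemma sum_binomial_step:
  fixes a b :: "nat \<Rightarrow> 'a::comm_ring_1"
  shows "(\<Sum>k\<le>n. of_nat (n choose k) * (a (Suc k) * b (n - k))) +
      (\<Sum>k\<le>n. of_nat (n choose k) * (a k * b (Suc (n - k)))) =
    (\<Sum>k\<le>Suc n. of_nat (Suc n choose k) * (a k * b (Suc n - k)))"
proof -
  have "(\<Sum>k\<le>n. of_nat (n choose k) * (a k * b (Suc (n - k)))) =
      (\<Sum>k\<le>Suc n. of_nat (n choose k) * (a k * b (Suc n - k)))"
    by (simp add: Suc_diff_le binomial_eq_0)
  also have "\<dots> = a 0 * b (Suc n) + (\<Sum>k\<le>n. of_nat (n choose Suc k) * (a (Suc k) * b (n - k)))"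
    by (simp add: sum.atMost_Suc_shift binomial_eq_0 del: sum.atMost_Suc)
  finally show ?thesis
    by (simp add: sum.atMost_Suc_shift sum.distrib[symmetric] algebra_simps
        del: sum.atMost_Suc)
qed

text \<open>
  The binomial theorem for \<open>f \<otimes> 1 + 1 \<otimes> f\<close>, the coproduct of a primitive tensor.
\<close>

lemma coprod_pow_primitive:
  assumes "primitive f" "length u + length v \<le> L"
  shows "coprod (tens_pow L f n) u v =
    (\<Sum>k\<le>n. of_nat (n choose k) * (tens_pow L f k u * tens_pow L f (n - k) v))"
  using assms(2)
proof (induction n arbitrary: u v)
  case 0
  then show ?case by (simp add: coprod_one)
next
  case (Suc n)
  let ?p = "tens_pow L f"
  have "(\<Sum>i\<le>length u. f (take i u) * coprod (?p n) (drop i u) v) =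
      (\<Sum>k\<le>n. of_nat (n choose k) * (?p (Suc k) u * ?p (n - k) v))"
  proof -
    have "(\<Sum>i\<le>length u. f (take i u) * coprod (?p n) (drop i u) v) =
        (\<Sum>i\<le>length u. \<Sum>k\<le>n. f (take i u) * (of_nat (n choose k) * (?p k (drop i u) * ?p (n - k) v)))"
      using Suc.prems by (intro sum.cong refl) (auto simp: Suc.IH sum_distrib_left)
    also have "\<dots> = (\<Sum>k\<le>n. \<Sum>i\<le>length u. f (take i u) * (of_nat (n choose k) * (?p k (drop i u) * ?p (n - k) v)))"
      by (rule sum.swap)
    also have "\<dots> = (\<Sum>k\<le>n. of_nat (n choose k) * (?p (Suc k) u * ?p (n - k) v))"
      using Suc.prems
      by (intro sum.cong refl) (auto simp: tens_mult_def sum_distrib_left sum_distrib_right ac_simps)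
    finally show ?thesis .
  qed
  moreover have "(\<Sum>j\<le>length v. f (take j v) * coprod (?p n) u (drop j v)) =
      (\<Sum>k\<le>n. of_nat (n choose k) * (?p k u * ?p (Suc (n - k)) v))"
  proof -
    have "(\<Sum>j\<le>length v. f (take j v) * coprod (?p n) u (drop j v)) =
        (\<Sum>j\<le>length v. \<Sum>k\<le>n. f (take j v) * (of_nat (n choose k) * (?p k u * ?p (n - k) (drop j v))))"
      using Suc.prems by (intro sum.cong refl) (auto simp: Suc.IH sum_distrib_left)
    also have "\<dots> = (\<Sum>k\<le>n. \<Sum>j\<le>length v. f (take j v) * (of_nat (n choose k) * (?p k u * ?p (n - k) (drop j v))))"
      by (rule sum.swap)
    also have "\<dots> = (\<Sum>k\<le>n. of_nat (n choose k) * (?p k u * ?p (Suc (n - k)) v))"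
      using Suc.prems
      by (intro sum.cong refl) (auto simp: tens_mult_def sum_distrib_left sum_distrib_right ac_simps)
    finally show ?thesis .
  qed
  ultimately show ?case
    using sum_binomial_step[of n "\<lambda>k. ?p k u" "\<lambda>k. ?p k v"]
      coprod_mult_primitive[OF assms(1) Suc.prems, of "?p n"]
    by (simp only: tens_pow.simps(2)[of L f n, symmetric])
qed

text \<open>
  By the binomial formula the coproduct of \<open>exp f\<close> is the Cauchy product of two exponential series; the
  terms beyond the triangle vanish because the powers of \<open>f\<close> vanish on short words.
\<close>

lemma grouplike_exp:
  fixes f :: "'a::{comm_ring_1, real_algebra_1} tens"
  assumes "primitive f"
  shows "grouplike L (tens_exp L f)"
  unfolding grouplike_def
proof (intro conjI allI impI)
  show "tens_exp L f [] = 1" using assms by (simp add: primitive_Nil)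
  fix u v :: "nat list"
  assume uv: "length u + length v \<le> L"
  let ?p = "tens_pow L f"
  have "tens_exp L f u * tens_exp L f v =
      (\<Sum>i\<le>L. \<Sum>j\<le>L. (1 / fact i * (1 / fact j)) *\<^sub>R (?p i u * ?p j v))"
    by (simp add: tens_exp_def sum_product mult.commute)
  also have "\<dots> = (\<Sum>n\<le>L. \<Sum>i\<le>n. (1 / fact i * (1 / fact (n - i))) *\<^sub>R (?p i u * ?p (n - i) v))"
  proof (rule sum_product_triangle)
    fix i j assume "i + j > L"
    with uv have "i > length u \<or> j > length v" by linarith
    then have "?p i u = 0 \<or> ?p j v = 0"
      using assms by (auto intro: tens_pow_nilpotent simp: primitive_Nil)
    then show "(1 / fact i * (1 / fact j)) *\<^sub>R (?p i u * ?p j v) = 0" by auto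
  qed
  also have "\<dots> = (\<Sum>n\<le>L. (1 / fact n) *\<^sub>R coprod (?p n) u v)"
  proof (intro sum.cong refl)
    fix n
    have "(1 / fact i * (1 / fact (n - i))) *\<^sub>R x = (1 / fact n) *\<^sub>R (of_nat (n choose i) * x)"
      if "i \<le> n" for i and x :: 'a
    proof -
      have "of_nat (n choose i) * x = real (n choose i) *\<^sub>R x"
        by (simp add: scaleR_conv_of_real)
      then show ?thesis using that by (simp add: binomial_fact)
    qed
    then show "(\<Sum>i\<le>n. (1 / fact i * (1 / fact (n - i))) *\<^sub>R (?p i u * ?p (n - i) v)) =
        (1 / fact n) *\<^sub>R coprod (?p n) u v"
      unfolding coprod_pow_primitive[OF assms uv] by (simp add: scaleR_sum_right)
  qed
  also have "\<dots> = coprod (tens_exp L f) u v"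
    by (simp add: tens_exp_def coprod_sum coprod_scaleR)
  finally show "coprod (tens_exp L f) u v = tens_exp L f u * tens_exp L f v" ..
qed

lemma grouplike_mult:
  assumes "grouplike L f" "grouplike L g"
  shows "grouplike L (tens_mult L f g)"
  unfolding grouplike_def
proof (intro conjI allI impI)
  show "tens_mult L f g [] = 1" using assms by (simp add: grouplike_def tens_mult_def)
  fix u v :: "nat list"
  assume uv: "length u + length v \<le> L"
  have "coprod (tens_mult L f g) u v = (\<Sum>i\<le>length u. \<Sum>j\<le>length v.
      (f (take i u) * g (drop i u)) * (f (take j v) * g (drop j v)))"
    unfolding coprod_mult[OF uv] using assms uv
    by (intro sum.cong refl) (auto simp: grouplike_def ac_simps)
  then show "coprod (tens_mult L f g) u v = tens_mult L f g u * tens_mult L f g v"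
    using uv by (simp add: tens_mult_def sum_product)
qed

text \<open>
  Induction on the degree \<open>n\<close> of \<open>u\<close> and \<open>v\<close> together. The part \<open>z'\<close> of \<open>z = log g\<close> of degree below
  \<open>n\<close> is primitive by induction, so \<open>exp z'\<close> is group-like. In degree \<open>n\<close> the tensors \<open>g = exp z\<close> and
  \<open>exp z'\<close> differ by the degree-\<open>n\<close> part of \<open>z\<close>, while they agree on \<open>u\<close> and \<open>v\<close>; comparing
  the two group-like identities leaves coproduct zero for that part.
\<close>

lemma primitive_log:
  fixes g :: "'a::{comm_ring_1, real_algebra_1} tens"
  assumes "grouplike L g"
  shows "primitive (tens_log L g)"
proof -
  let ?z = "tens_log L g"
  have g1: "g [] = 1" using assms by (simp add: grouplike_def)
  have "coprod ?z u v = 0" if "length u + length v = n" "u \<noteq> []" "v \<noteq> []" for n u v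
    using that
  proof (induction n arbitrary: u v rule: less_induct)
    case (less n)
    show ?case
    proof (cases "n \<le> L")
      case False
      then have "coprod ?z u v = coprod (\<lambda>t. 0) u v"
        using less.prems by (intro coprod_cong_length) (simp add: tens_log_eq_series)
      then show ?thesis by simp
    next
      case True
      define z' where "z' = (\<lambda>t. if length t < n then ?z t else 0)"
      have z'0: "z' [] = 0" using g1 by (simp add: z'_def)
      have prim: "primitive z'" unfolding primitive_def
      proof (intro conjI allI impI)
        fix a b :: "nat list" assume ab: "a \<noteq> []" "b \<noteq> []"
        show "coprod z' a b = 0"
        proof (cases "length a + length b < n")
          case True
          then have "coprod z' a b = coprod ?z a b"
            by (intro coprod_cong_length) (simp add: z'_def)
          then show ?thesis using less.IH[OF True] ab by simp
        next
          case False
          then have "coprod z' a b = coprod (\<lambda>t. 0) a b"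
            by (intro coprod_cong_length) (simp add: z'_def)
          then show ?thesis by simp
        qed
      qed (rule z'0)
      have g: "g t = tens_exp L z' t + (?z t - z' t)" if "length t \<le> n" for t
      proof -
        have "tens_exp L ?z t - ?z t = tens_exp L z' t - z' t"
          using tens_series_cong_less[of ?z z' t L "fps_exp 1"] g1 z'0 that True
          by (auto simp: tens_exp_eq_series z'_def)
        moreover have "tens_exp L ?z t = g t" using tens_exp_log[of g t L] g1 that True by simp
        ultimately show ?thesis by (simp add: algebra_simps)
      qed
      have uv: "length u + length v \<le> L" "length u < n" "length v < n"
        using less.prems True by auto
      have "tens_exp L z' u * tens_exp L z' v = g u * g v" using g uv by (simp add: z'_def)
      also have "\<dots> = coprod g u v" using assms uv by (simp add: grouplike_def)
      also have "\<dots> = coprod (\<lambda>t. tens_exp L z' t + ?z t) u v"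
        using less.prems by (intro coprod_cong_length) (simp add: g z'_def)
      also have "\<dots> = tens_exp L z' u * tens_exp L z' v + coprod ?z u v"
        using grouplike_exp[OF prim, of L] uv by (simp add: coprod_add grouplike_def)
      finally show ?thesis by simp
    qed
  qed
  then show ?thesis using g1 by (auto simp: primitive_def)
qed

definition bch :: "nat \<Rightarrow> 'a::{comm_ring_1, real_algebra_1} tens \<Rightarrow> 'a tens \<Rightarrow> 'a tens" where
  "bch L f g = tens_log L (tens_mult L (tens_exp L f) (tens_exp L g))"

lemma primitive_bch: "primitive f \<Longrightarrow> primitive g \<Longrightarrow> primitive (bch L f g)"
  unfolding bch_def by (intro primitive_log grouplike_mult grouplike_exp)

lemma bch_long [simp]: "length v > L \<Longrightarrow> bch L f g v = 0"
  by (simp add: bch_def tens_log_eq_series)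


section \<open>Lyndon brackets\<close>

definition short_words :: "nat \<Rightarrow> nat \<Rightarrow> nat list set" where
  "short_words d L = {v. set v \<subseteq> {1..d} \<and> length v \<le> L}"

lemma finite_short_words [simp]: "finite (short_words d L)"
  unfolding short_words_def by (rule finite_lists_length_le) simp

text \<open>
  Stated by vanishing, membership is visibly stable under linear operations.
\<close>

lemma tens_space_iff: "f \<in> tens_space d L \<longleftrightarrow> (\<forall>v. v \<notin> short_words d L \<longrightarrow> f v = 0)"
  by (auto simp: tens_space_def short_words_def)

lemma tens_mult_homogeneous:
  assumes "\<And>t. f t \<noteq> 0 \<Longrightarrow> length t = p" "p \<le> length t" "length t \<le> L"
  shows "tens_mult L f g t = f (take p t) * g (drop p t)"
proof -
  have "(\<Sum>k\<le>length t. f (take k t) * g (drop k t)) = (\<Sum>k\<in>{p}. f (take k t) * g (drop k t))"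
  proof (rule sum.mono_neutral_right)
    have "f (take k t) = 0" if "k \<le> length t" "k \<noteq> p" for k
      using assms(1)[of "take k t"] that by auto
    then show "\<forall>k\<in>{..length t} - {p}. f (take k t) * g (drop k t) = 0" by simp
  qed (use assms in auto)
  then show ?thesis using assms by (simp add: tens_mult_def)
qed

lemma tens_mult_nonzeroD:
  assumes "tens_mult L f g t \<noteq> 0"
  obtains k where "k \<le> length t" "f (take k t) \<noteq> 0" "g (drop k t) \<noteq> 0"
proof -
  have "\<exists>k\<le>length t. f (take k t) * g (drop k t) \<noteq> 0"
    using assms by (auto simp: tens_mult_def split: if_splits elim: sum.not_neutral_contains_not_neutral)
  then obtain k where "k \<le> length t" "f (take k t) * g (drop k t) \<noteq> 0" by blast
  then show ?thesis using that by (metis mult_zero_left mult_zero_right)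
qed

lemma tens_mult_hom:
  assumes "\<phi> 0 = 0" "\<And>x y. \<phi> (x + y) = \<phi> x + \<phi> y" "\<And>x y. \<phi> (x * y) = \<phi> x * \<phi> y"
  shows "tens_mult L (\<lambda>u. \<phi> (f u)) (\<lambda>u. \<phi> (g u)) v = \<phi> (tens_mult L f g v)"
proof -
  have "\<phi> (sum h A) = (\<Sum>x\<in>A. \<phi> (h x))" for h and A :: "nat set"
    using sum_comp_morphism[of \<phi> h A, OF assms(1,2)] by (simp add: comp_def)
  then show ?thesis by (simp add: tens_mult_def assms)
qed

text \<open>
  Lyndon brackets have integer coefficients, independent of the coefficient ring. Hence they are fixed
  by homomorphisms, and additive subgroups are stable under multiplication by these coefficients.
\<close>

lemma lyndon_bracket_of_int:
  "lyndon_bracket L w v = (of_int (lyndon_bracket L w v) :: 'a::comm_ring_1)"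
proof (induction L w arbitrary: v rule: lyndon_bracket.induct)
  case (1 L w)
  show ?case
  proof (cases "lyndon_splits w = {}")
    case True
    then show ?thesis by (simp add: lyndon_bracket.simps[of _ w] tens_word_def)
  next
    case False
    let ?k = "LEAST k. k \<in> lyndon_splits w"
    have eq: "(lyndon_bracket L (take ?k w) :: 'a tens) = (\<lambda>v. of_int (lyndon_bracket L (take ?k w) v))"
      "(lyndon_bracket L (drop ?k w) :: 'a tens) = (\<lambda>v. of_int (lyndon_bracket L (drop ?k w) v))"
      using 1 False by (blast intro: ext)+
    show ?thesis
      using False
      by (subst (1 2) lyndon_bracket.simps)
         (simp add: eq tens_bracket_def tens_mult_hom[of "of_int :: int \<Rightarrow> 'a"])
  qed
qed

lemma lyndon_bracket_letter: "lyndon_bracket L [i] = tens_word [i]"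
  by (subst lyndon_bracket.simps) (auto simp: lyndon_splits_def)

lemma lyndon_bracket_cases [consumes 1, case_names letter bracket]:
  assumes "lyndon w"
  obtains i where "w = [i]"
  | u v where "w = u @ v" "lyndon u" "lyndon v" "u \<noteq> []" "v \<noteq> []"
      "\<And>L. lyndon_bracket L w = (tens_bracket L (lyndon_bracket L u) (lyndon_bracket L v) :: 'a::comm_ring_1 tens)"
proof (cases "length w \<ge> 2")
  case True
  let ?k = "LEAST k. k \<in> lyndon_splits w"
  have ne: "lyndon_splits w \<noteq> {}" using assms True by (rule lyndon_splits_nonempty)
  then have k: "?k \<in> lyndon_splits w" by (metis LeastI ex_in_conv)
  show ?thesis
  proof (rule that(2)[of "take ?k w" "drop ?k w"])
    show "lyndon_bracket L w = (tens_bracket L (lyndon_bracket L (take ?k w))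
       (lyndon_bracket L (drop ?k w)) :: 'a tens)" for L
      using ne by (subst lyndon_bracket.simps) simp
  qed (use k in \<open>auto simp: lyndon_splits_def\<close>)
next
  case False
  with assms have "length w = 1" by (cases "length w") (auto simp: lyndon_iff)
  then show ?thesis using that(1) by (auto simp: length_Suc_conv)
qed

lemma lyndon_induct [consumes 1, case_names letter bracket]:
  assumes "lyndon w"
    and "\<And>i. P [i]"
    and "\<And>u v. lyndon (u @ v) \<Longrightarrow> lyndon u \<Longrightarrow> lyndon v \<Longrightarrow> u \<noteq> [] \<Longrightarrow> v \<noteq> [] \<Longrightarrow>
      (\<And>L. lyndon_bracket L (u @ v) = (tens_bracket L (lyndon_bracket L u) (lyndon_bracket L v) :: 'a::comm_ring_1 tens)) \<Longrightarrow>
      P u \<Longrightarrow> P v \<Longrightarrow> P (u @ v)"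
  shows "P w"
  using assms(1)
proof (induction w rule: length_induct)
  case (1 w)
  from 1(2) show ?case
  proof (cases rule: lyndon_bracket_cases[where 'a = 'a])
    case (letter i)
    then show ?thesis using assms(2) by simp
  next
    case (bracket u v)
    then show ?thesis using 1 assms(3)[of u v] by simp
  qed
qed

text \<open>
  Triangularity. For \<open>w = u @ v\<close> the products of terms of the two factors are at least \<open>u @ v\<close> in
  one order and at least \<open>v @ u\<close> in the other, and \<open>u @ v < v \<le> v @ u\<close> as \<open>u @ v\<close> is Lyndon. So the
  leading word is \<open>u @ v\<close>, with the product of the two leading coefficients.
\<close>

lemma lyndon_bracket_support:
  assumes "lyndon w" "length w \<le> L"
  shows "lyndon_bracket L w w = (1 :: 'a::comm_ring_1)"
    and "lyndon_bracket L w t \<noteq> (0 :: 'a) \<Longrightarrow> length t = length w \<and> set t \<subseteq> set w \<and> w \<le> t"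
proof -
  let ?B = "\<lambda>w. lyndon_bracket L w :: 'a tens"
  have "?B w w = 1 \<and> (\<forall>t. ?B w t \<noteq> 0 \<longrightarrow> length t = length w \<and> set t \<subseteq> set w \<and> lexordp_eq w t)"
    using assms
  proof (induction w rule: lyndon_induct[where 'a = 'a])
    case (letter i)
    then show ?case by (auto simp: lyndon_bracket_letter tens_word_def lexordp_eq_refl)
  next
    case (bracket u v)
    have len: "length u \<le> L" "length v \<le> L" "length u + length v \<le> L" using bracket.prems by auto
    have IHu: "?B u u = 1" "\<And>t. ?B u t \<noteq> 0 \<Longrightarrow> length t = length u \<and> set t \<subseteq> set u \<and> lexordp_eq u t"
      using bracket.IH(1)[OF len(1)] by blast+
    have IHv: "?B v v = 1" "\<And>t. ?B v t \<noteq> 0 \<Longrightarrow> length t = length v \<and> set t \<subseteq> set v \<and> lexordp_eq v t"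
      using bracket.IH(2)[OF len(2)] by blast+
    have "strict_suffix v (u @ v)" using bracket(4) by (auto simp: strict_suffix_def suffix_def)
    with bracket(1,5) have "\<not> lexordp_eq v (u @ v)" by (simp add: lyndon_iff)
    then have gt: "\<not> lexordp_eq (v @ u) (u @ v)" using lexordp_eq_appendD by fastforce
    have prod: "length t = length a + length b \<and> set t \<subseteq> set a \<union> set b \<and> lexordp_eq (a @ b) t"
      if "tens_mult L (?B a) (?B b) t \<noteq> 0"
        and a: "\<And>t. ?B a t \<noteq> 0 \<Longrightarrow> length t = length a \<and> set t \<subseteq> set a \<and> lexordp_eq a t"
        and b: "\<And>t. ?B b t \<noteq> 0 \<Longrightarrow> length t = length b \<and> set t \<subseteq> set b \<and> lexordp_eq b t" for a b t
    proof -
      from that(1) obtain k where k: "k \<le> length t" "?B a (take k t) \<noteq> 0" "?B b (drop k t) \<noteq> 0"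
        by (rule tens_mult_nonzeroD)
      note * = a[OF k(2)] b[OF k(3)]
      have "lexordp_eq (a @ b) (take k t @ drop k t)"
        by (rule lexordp_eq_append_mono) (use * in auto)
      moreover have "length t = length a + length b" using * k(1) by auto
      moreover have "set t \<subseteq> set a \<union> set b"
        using * by (metis Un_mono append_take_drop_id set_append)
      ultimately show ?thesis by simp
    qed
    have 0: "tens_mult L (?B v) (?B u) (u @ v) = 0"
      using prod[of v u "u @ v", OF _ IHv(2) IHu(2)] gt by blast
    have 1: "tens_mult L (?B u) (?B v) (u @ v) = 1"
    proof -
      have "tens_mult L (?B u) (?B v) (u @ v) =
          ?B u (take (length u) (u @ v)) * ?B v (drop (length u) (u @ v))"
        by (rule tens_mult_homogeneous) (use len(3) in \<open>auto dest: IHu(2)\<close>)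
      then show ?thesis by (simp add: IHu(1) IHv(1))
    qed
    have "length t = length (u @ v) \<and> set t \<subseteq> set (u @ v) \<and> lexordp_eq (u @ v) t"
      if "tens_bracket L (?B u) (?B v) t \<noteq> 0" for t
    proof -
      from that consider "tens_mult L (?B u) (?B v) t \<noteq> 0" | "tens_mult L (?B v) (?B u) t \<noteq> 0"
        unfolding tens_bracket_def by fastforce
      then show ?thesis
      proof cases
        case 1
        from prod[OF 1 IHu(2) IHv(2)] show ?thesis by auto
      next
        case 2
        from prod[OF 2 IHv(2) IHu(2)]
        have "length t = length v + length u \<and> set t \<subseteq> set v \<union> set u \<and> lexordp_eq (v @ u) t" .
        moreover have "lexordp_eq (u @ v) (v @ u)" using gt lexordp_eq_linear by blast
        ultimately show ?thesis using lexordp_eq_trans[of "u @ v" "v @ u" t] by auto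
      qed
    qed
    moreover have "tens_bracket L (?B u) (?B v) (u @ v) = 1" by (simp add: tens_bracket_def 0 1)
    ultimately show ?case unfolding bracket(6) by blast
  qed
  then show "?B w w = 1" and "?B w t \<noteq> 0 \<Longrightarrow> length t = length w \<and> set t \<subseteq> set w \<and> w \<le> t"
    by (auto simp only: less_eq_list_same_length)
qed

lemma primitive_lyndon_bracket: "lyndon w \<Longrightarrow> primitive (lyndon_bracket L w :: 'a::comm_ring_1 tens)"
proof (induction w rule: lyndon_induct[where 'a = 'a])
  case (letter i)
  then show ?case by (simp add: lyndon_bracket_letter primitive_letter)
next
  case (bracket u v)
  then show ?case by (simp add: primitive_bracket)
qed

lemma free_lie_iff:
  "f \<in> free_lie d L \<longleftrightarrow> (\<forall>S. lie_subalgebra d L S \<longrightarrow> (\<forall>i\<in>{1..d}. tens_word [i] \<in> S) \<longrightarrow> f \<in> S)"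
  by (auto simp: free_lie_def hull_def)

lemma lyndon_bracket_in_lie_subalgebra:
  assumes "lyndon w" "set w \<subseteq> {1..d}" "lie_subalgebra d L S" "\<And>i. i \<in> {1..d} \<Longrightarrow> tens_word [i] \<in> S"
  shows "lyndon_bracket L w \<in> S"
  using assms(1,2)
proof (induction w rule: lyndon_induct[where 'a = real])
  case (letter i)
  then show ?case using assms(4)[of i] by (simp add: lyndon_bracket_letter)
next
  case (bracket u v)
  then show ?case using assms(3) by (simp add: lie_subalgebra_def)
qed

lemma finite_lyndon_words [simp]: "finite (lyndon_words d L)"
  by (rule finite_subset[OF _ finite_short_words[of d L]]) (auto simp: lyndon_words_def short_words_def)

text \<open>
  Otherwise \<open>w\<close> is the largest shuffle of some nonempty \<open>u\<close> and \<open>v\<close>; the smaller ones lie outside the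
  support, so orthogonality to this shuffle says that a positive multiple of \<open>f w\<close> is zero. Dividing by the
  multiplicity uses the real scalars.
\<close>

lemma primitive_smallest_word_lyndon:
  fixes f :: "'a::{comm_ring_1, real_algebra_1} tens"
  assumes "primitive f" "f w \<noteq> 0" "\<And>t. t < w \<Longrightarrow> f t = 0"
  shows "lyndon w"
proof (rule ccontr)
  assume "\<not> lyndon w"
  moreover have "w \<noteq> []" using assms primitive_Nil by blast
  ultimately obtain u v where uv: "u \<noteq> []" "v \<noteq> []" "w = u @ v" "\<And>t. t \<in> shuffles u v \<Longrightarrow> lexordp_eq t w"
    using not_lyndon_split by blast
  have "f t = 0" if "t \<in> shuffles u v" "t \<noteq> w" for t
  proof -
    have "length t = length w" using that uv by (simp add: length_shuffles)
    then have "t \<le> w" using uv(4)[OF that(1)] by (simp add: less_eq_list_same_length)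
    then show ?thesis using assms(3) that by simp
  qed
  moreover have "w \<in> shuffles u v"
    unfolding uv(3) by (induction u) (auto intro: Cons_in_shuffles_leftI)
  ultimately obtain n :: nat where n: "n > 0" "coprod f u v = of_nat n * f w"
    using coprod_eq_multiple[of u v w f] by blast
  have "of_nat n * f w = real n *\<^sub>R f w" by (simp add: scaleR_conv_of_real)
  then show False using n uv assms by (simp add: primitive_def)
qed

text \<open>
  Elimination of the smallest word. The support is kept inside a set \<open>U\<close> of words that is closed upwards,
  so that subtracting a multiple of the Lyndon bracket of the least element of \<open>U\<close> stays inside
  \<open>U\<close> and removes this element.
\<close>

lemma primitive_lyndon_combination:
  fixes f :: "'a::{comm_ring_1, real_algebra_1} tens"
  assumes "primitive f" "f \<in> tens_space d L"
  shows "\<exists>z. f = (\<lambda>v. \<Sum>w\<in>lyndon_words d L. z w * lyndon_bracket L w v)"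
proof -
  let ?W = "short_words d L"
  have "\<exists>z. f = (\<lambda>v. \<Sum>w\<in>lyndon_words d L. z w * lyndon_bracket L w v)"
    if "finite U" "U \<subseteq> ?W" "\<forall>u\<in>U. \<forall>v\<in>?W. u \<le> v \<longrightarrow> v \<in> U"
      "primitive f" "\<forall>v. v \<notin> U \<longrightarrow> f v = 0" for U and f :: "'a tens"
    using that
  proof (induction U arbitrary: f rule: finite_psubset_induct)
    case (psubset U)
    show ?case
    proof (cases "U = {}")
      case True
      then have "f = (\<lambda>v. \<Sum>w\<in>lyndon_words d L. 0 * lyndon_bracket L w v)" using psubset.prems by auto
      then show ?thesis by (rule exI[of _ "\<lambda>w. 0"])
    next
      case False
      define w where "w = Min U"
      have w: "w \<in> U" and min: "\<And>u. u \<in> U \<Longrightarrow> w \<le> u" using psubset.hyps False by (auto simp: w_def)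
      have sub: "U - {w} \<subset> U" "U - {w} \<subseteq> ?W" using w psubset.prems(1) by auto
      have up: "\<forall>u\<in>U - {w}. \<forall>v\<in>?W. u \<le> v \<longrightarrow> v \<in> U - {w}"
        using min psubset.prems(2) by force
      show ?thesis
      proof (cases "f w = 0")
        case True
        then have "\<forall>v. v \<notin> U - {w} \<longrightarrow> f v = 0" using psubset.prems(4) by auto
        then show ?thesis using psubset.IH[OF sub up psubset.prems(3)] by blast
      next
        case fw: False
        have "f t = 0" if "t < w" for t using psubset.prems(4) min[of t] that by force
        with fw have lw: "lyndon w" using primitive_smallest_word_lyndon psubset.prems(3) by blast
        with w psubset.prems(1) have wL: "w \<in> lyndon_words d L" "length w \<le> L"
          by (auto simp: lyndon_words_def short_words_def)
        define f' where "f' = (\<lambda>v. f v - f w * lyndon_bracket L w v)"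
        have "primitive f'" unfolding f'_def
          by (intro primitive_diff primitive_mult_left primitive_lyndon_bracket psubset.prems lw)
        moreover have "\<forall>v. v \<notin> U - {w} \<longrightarrow> f' v = 0"
        proof (intro allI impI, rule ccontr)
          fix v assume "v \<notin> U - {w}" and that: "f' v \<noteq> 0"
          moreover have "v \<noteq> w" using that lyndon_bracket_support(1)[OF lw wL(2), where 'a = 'a] by (auto simp: f'_def)
          moreover have "v \<in> U"
          proof (cases "f v = 0")
            case True
            with that have "lyndon_bracket L w v \<noteq> (0 :: 'a)" by (auto simp: f'_def)
            from lyndon_bracket_support(2)[OF lw wL(2) this] have "v \<in> ?W" "w \<le> v"
              using wL by (auto simp: short_words_def lyndon_words_def)
            then show ?thesis using psubset.prems(2) w by blast
          qed (use psubset.prems(4) in blast)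
          ultimately show False by blast
        qed
        ultimately obtain z where z: "f' = (\<lambda>v. \<Sum>w\<in>lyndon_words d L. z w * lyndon_bracket L w v)"
          using psubset.IH[OF sub up, of f'] by blast
        have "f v = (\<Sum>w'\<in>lyndon_words d L. (z w' + (if w' = w then f w else 0)) * lyndon_bracket L w' v)" for v
        proof -
          have "(\<Sum>w'\<in>lyndon_words d L. (z w' + (if w' = w then f w else 0)) * lyndon_bracket L w' v) =
              f' v + (\<Sum>w'\<in>lyndon_words d L. if w' = w then f w * lyndon_bracket L w' v else 0)"
            unfolding z sum.distrib[symmetric] by (intro sum.cong refl) (auto simp: distrib_right)
          also have "\<dots> = f v" using wL by (simp add: f'_def)
          finally show ?thesis ..
        qed
        then show ?thesis by (intro exI[of _ "\<lambda>w'. z w' + (if w' = w then f w else 0)"] ext)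
      qed
    qed
  qed
  from this[OF finite_short_words subset_refl _ assms(1)] assms(2) show ?thesis
    by (simp add: tens_space_iff)
qed

definition additive_subgroup :: "'a::comm_ring_1 set \<Rightarrow> bool" where
  "additive_subgroup S \<longleftrightarrow> 0 \<in> S \<and> (\<forall>x\<in>S. \<forall>y\<in>S. x - y \<in> S)"

lemma additive_subgroup_add: "additive_subgroup S \<Longrightarrow> x \<in> S \<Longrightarrow> y \<in> S \<Longrightarrow> x + y \<in> S"
  unfolding additive_subgroup_def by (metis diff_0 diff_minus_eq_add)

lemma additive_subgroup_sum:
  "additive_subgroup S \<Longrightarrow> (\<And>i. i \<in> I \<Longrightarrow> f i \<in> S) \<Longrightarrow> sum f I \<in> S"
  by (induction I rule: infinite_finite_induct)
     (auto simp: additive_subgroup_add, auto simp: additive_subgroup_def)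

lemma additive_subgroup_of_int:
  assumes "additive_subgroup S" "x \<in> S"
  shows "x * of_int k \<in> S"
proof (induction k rule: int_induct[of _ 0])
  case base
  then show ?case using assms by (simp add: additive_subgroup_def)
next
  case (step1 i)
  then show ?case using assms by (simp add: distrib_left additive_subgroup_add)
next
  case (step2 i)
  then show ?case using assms by (simp add: right_diff_distrib additive_subgroup_def)
qed

text \<open>
  Back substitution in the unitriangular integral system that relates coefficients at words of length
  \<open>n\<close> to coefficients in the Lyndon basis. For \<open>S = {0}\<close> this is linear independence; for a subring of
  polynomials in fewer variables it bounds the variables of the coordinates.
\<close>

lemma lyndon_coefficients_in:
  fixes z :: "nat list \<Rightarrow> 'a::comm_ring_1"
  assumes S: "additive_subgroup S"
    and "\<And>v. length v = n \<Longrightarrow> (\<Sum>w\<in>lyndon_words d L. z w * lyndon_bracket L w v) \<in> S"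
    and "w \<in> lyndon_words d L" "length w = n"
  shows "z w \<in> S"
  using assms(3,4)
proof (induction w rule: less_induct)
  case (less w)
  let ?t = "\<lambda>w'. z w' * lyndon_bracket L w' w"
  have "(\<Sum>w'\<in>lyndon_words d L - {w}. ?t w') \<in> S"
  proof (rule additive_subgroup_sum[OF S])
    fix w' assume w': "w' \<in> lyndon_words d L - {w}"
    show "?t w' \<in> S"
    proof (cases "lyndon_bracket L w' w = (0 :: 'a)")
      case True
      then show ?thesis using S by (simp add: additive_subgroup_def)
    next
      case False
      have "length w = length w'" "w' \<le> w"
        using lyndon_bracket_support(2)[OF _ _ False] w' by (auto simp: lyndon_words_def)
      then have "z w' \<in> S" using less w' by auto
      then show ?thesis
        by (subst lyndon_bracket_of_int) (rule additive_subgroup_of_int[OF S])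
    qed
  qed
  moreover have "(\<Sum>w'\<in>lyndon_words d L. ?t w') - (\<Sum>w'\<in>lyndon_words d L - {w}. ?t w') = z w"
    using less.prems lyndon_bracket_support(1)[of w L, where 'a = 'a]
    by (subst sum.remove[of "lyndon_words d L" w]) (auto simp del: finite_lyndon_words intro: finite_lyndon_words, auto simp: lyndon_words_def)
  ultimately show ?case using assms(2)[OF less.prems(2)] S unfolding additive_subgroup_def by metis
qed

section \<open>The Lyndon basis\<close>

definition lyndon_word :: "nat \<Rightarrow> nat \<Rightarrow> nat \<Rightarrow> nat list" where
  "lyndon_word d L j = sorted_list_of_set (lyndon_words d L) ! (j - 1)"

lemma lie_basis_eq: "lie_basis d L j = lyndon_bracket L (lyndon_word d L j)"
  by (simp add: lie_basis_def lyndon_word_def)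

lemma bij_betw_lyndon_word: "bij_betw (lyndon_word d L) {1..lie_dim d L} (lyndon_words d L)"
proof -
  have "bij_betw (\<lambda>i. sorted_list_of_set (lyndon_words d L) ! i) {..<lie_dim d L} (lyndon_words d L)"
    by (rule bij_betw_nth) (auto simp: lie_dim_def)
  moreover have "bij_betw (\<lambda>j. j - 1) {1..lie_dim d L} {..<lie_dim d L}"
    by (rule bij_betwI[of _ _ _ Suc]) auto
  ultimately show ?thesis
    using bij_betw_trans unfolding lyndon_word_def comp_def by fastforce
qed

lemma lyndon_word_length_less:
  assumes "i \<in> {1..lie_dim d L}" "j \<in> {1..lie_dim d L}"
    and "length (lyndon_word d L i) < length (lyndon_word d L j)"
  shows "i < j"
proof (rule ccontr)
  assume "\<not> i < j"
  then have "lyndon_word d L j \<le> lyndon_word d L i"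
    unfolding lyndon_word_def using assms(1,2)
    by (intro sorted_nth_mono) (auto simp: lie_dim_def)
  then show False using assms(3) less_eq_list_length by fastforce
qed

lemma lie_comb_lyndon:
  assumes "\<And>b. b \<in> {1..lie_dim d L} \<Longrightarrow> z b = z' (lyndon_word d L b)"
  shows "lie_comb d L z v = (\<Sum>w\<in>lyndon_words d L. z' w * lyndon_bracket L w v)"
  unfolding lie_comb_def
  by (subst sum.reindex_bij_betw[OF bij_betw_lyndon_word, symmetric])
     (auto simp: lie_basis_eq assms intro!: sum.cong)

lemma lie_comb_cong:
  "(\<And>b. b \<in> {1..lie_dim d L} \<Longrightarrow> z b = z' b) \<Longrightarrow> lie_comb d L z = lie_comb d L z'"
  unfolding lie_comb_def by (intro ext sum.cong) auto

lemma lie_comb_coefficients_in: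
  assumes "additive_subgroup S" "\<And>v. length v = n \<Longrightarrow> lie_comb d L z v \<in> S"
    and "b \<in> {1..lie_dim d L}" "length (lyndon_word d L b) = n"
  shows "z b \<in> S"
proof -
  define z' where "z' w = z (the_inv_into {1..lie_dim d L} (lyndon_word d L) w)" for w
  have z': "z b = z' (lyndon_word d L b)" if "b \<in> {1..lie_dim d L}" for b
    using that bij_betw_lyndon_word[of d L] by (simp add: z'_def bij_betw_def the_inv_into_f_f)
  have "z' (lyndon_word d L b) \<in> S"
  proof (rule lyndon_coefficients_in[OF assms(1)])
    show "(\<Sum>w\<in>lyndon_words d L. z' w * lyndon_bracket L w v) \<in> S" if "length v = n" for v
      using assms(2)[OF that] lie_comb_lyndon[of d L z z' v, OF z'] by simp
    show "lyndon_word d L b \<in> lyndon_words d L" using assms(3) bij_betw_lyndon_word bij_betwE by blast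
  qed (rule assms(4))
  then show ?thesis using z'[OF assms(3)] by simp
qed

lemma lie_comb_inject:
  fixes z z' :: "nat \<Rightarrow> 'a::comm_ring_1"
  assumes "lie_comb d L z = lie_comb d L z'" "b \<in> {1..lie_dim d L}"
  shows "z b = z' b"
proof -
  have "z b - z' b \<in> {0}"
  proof (rule lie_comb_coefficients_in[where z = "\<lambda>b. z b - z' b", OF _ _ assms(2) refl])
    show "additive_subgroup {0 :: 'a}" by (simp add: additive_subgroup_def)
    show "lie_comb d L (\<lambda>b. z b - z' b) v \<in> {0}" for v
      using fun_cong[OF assms(1), of v] by (simp add: lie_comb_def left_diff_distrib sum_subtractf)
  qed
  then show ?thesis by simp
qed

lemma lie_dual_lie_comb:
  assumes "j \<in> {1..lie_dim d L}"
  shows "lie_dual d L j (lie_comb d L z) = z j"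
proof -
  \<comment> \<open>The dual basis is described by coordinates that vanish outside the index range.\<close>
  define z' where "z' b = (if b \<in> {1..lie_dim d L} then z b else 0)" for b
  have *: "lie_comb d L z = lie_comb d L z'" by (rule lie_comb_cong) (simp add: z'_def)
  have "(THE y. (\<forall>b. b \<notin> {1..lie_dim d L} \<longrightarrow> y b = 0) \<and> lie_comb d L z = lie_comb d L y) = z'"
  proof (rule the_equality)
    fix y assume y: "(\<forall>b. b \<notin> {1..lie_dim d L} \<longrightarrow> y b = 0) \<and> lie_comb d L z = lie_comb d L y"
    then have "y b = z' b" for b
      using lie_comb_inject[of d L z y b] by (cases "b \<in> {1..lie_dim d L}") (auto simp: z'_def)
    then show "y = z'" by blast
  qed (use * in \<open>auto simp: z'_def\<close>)
  then show ?thesis using assms by (simp add: lie_dual_def z'_def)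
qed

lemma lie_basis_primitive:
  assumes "b \<in> {1..lie_dim d L}"
  shows "primitive (lie_basis d L b :: 'a::comm_ring_1 tens)"
    and "(lie_basis d L b :: 'a tens) \<in> tens_space d L"
proof -
  have w: "lyndon_word d L b \<in> lyndon_words d L"
    using assms bij_betw_lyndon_word bij_betwE by blast
  then show "primitive (lie_basis d L b :: 'a tens)"
    by (simp add: lie_basis_eq lyndon_words_def primitive_lyndon_bracket)
  show "(lie_basis d L b :: 'a tens) \<in> tens_space d L"
    unfolding tens_space_def lie_basis_eq
  proof (intro CollectI allI impI)
    fix v assume "lyndon_bracket L (lyndon_word d L b) v \<noteq> (0 :: 'a)"
    from lyndon_bracket_support(2)[OF _ _ this] w show "set v \<subseteq> {1..d} \<and> length v \<le> L"
      unfolding lyndon_words_def by force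
  qed
qed

lemma primitive_lie_comb: "primitive (lie_comb d L z)"
  unfolding lie_comb_def by (intro primitive_sum primitive_mult_left lie_basis_primitive)

lemma lie_comb_in_tens_space: "lie_comb d L z \<in> tens_space d L"
  using lie_basis_primitive(2)[of _ d L, where 'a = 'a]
  by (simp add: lie_comb_def tens_space_iff)

lemma lie_comb_Nil [simp]: "lie_comb d L z [] = 0"
  using primitive_lie_comb by (rule primitive_Nil)

theorem primitive_eq_lie_comb:
  fixes f :: "'a::{comm_ring_1, real_algebra_1} tens"
  assumes "primitive f" "f \<in> tens_space d L"
  obtains z where "f = lie_comb d L z"
proof -
  from primitive_lyndon_combination[OF assms]
  obtain z where z: "f = (\<lambda>v. \<Sum>w\<in>lyndon_words d L. z w * lyndon_bracket L w v)" by blast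
  have "f = lie_comb d L (\<lambda>b. z (lyndon_word d L b))"
    unfolding z by (rule ext, rule lie_comb_lyndon[symmetric]) simp
  then show ?thesis by (rule that)
qed

lemma tens_mult_in_tens_space:
  assumes "f \<in> tens_space d L" "g \<in> tens_space d L"
  shows "tens_mult L f g \<in> tens_space d L"
  unfolding tens_space_def
proof (intro CollectI allI impI)
  fix v assume nz: "tens_mult L f g v \<noteq> 0"
  then obtain k where "f (take k v) \<noteq> 0" "g (drop k v) \<noteq> 0" by (rule tens_mult_nonzeroD)
  then have "set (take k v) \<subseteq> {1..d}" "set (drop k v) \<subseteq> {1..d}" using assms by (auto simp: tens_space_def)
  then have "set (take k v @ drop k v) \<subseteq> {1..d}" by (simp only: set_append Un_least)
  moreover have "length v \<le> L" using nz by (rule contrapos_np) simp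
  ultimately show "set v \<subseteq> {1..d} \<and> length v \<le> L" by simp
qed

lemma tens_space_sum: "(\<And>k. k \<in> K \<Longrightarrow> f k \<in> tens_space d L) \<Longrightarrow> (\<lambda>v. \<Sum>k\<in>K. f k v) \<in> tens_space d L"
  by (simp add: tens_space_iff)

lemma tens_word_Nil_in_tens_space: "tens_word [] \<in> tens_space d L"
  by (simp add: tens_space_def tens_word_def)

lemma tens_series_in_tens_space:
  assumes "f \<in> tens_space d L"
  shows "tens_series L F f \<in> tens_space d L"
  unfolding tens_series_def
proof (rule tens_space_sum)
  fix k
  have "tens_pow L f k \<in> tens_space d L"
    by (induction k) (auto intro: tens_mult_in_tens_space assms tens_word_Nil_in_tens_space)
  then show "(\<lambda>v. fps_nth F k *\<^sub>R tens_pow L f k v) \<in> tens_space d L" by (auto simp: tens_space_def)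
qed

lemma bch_in_tens_space:
  assumes "f \<in> tens_space d L" "g \<in> tens_space d L"
  shows "bch L f g \<in> tens_space d L"
proof -
  have "tens_mult L (tens_exp L f) (tens_exp L g) \<in> tens_space d L" (is "?h \<in> _")
    unfolding tens_exp_eq_series by (intro tens_mult_in_tens_space tens_series_in_tens_space assms)
  then have "(\<lambda>u. ?h u - tens_word [] u) \<in> tens_space d L"
    using tens_word_Nil_in_tens_space[of d L, where 'a = 'a] by (simp add: tens_space_iff)
  then show ?thesis unfolding bch_def tens_log_eq_series by (rule tens_series_in_tens_space)
qed

text \<open>
  The Baker--Campbell--Hausdorff theorem in coordinates: primitive tensors are combinations of Lyndon
  brackets, and \<open>bch\<close> preserves primitivity.
\<close>

theorem bch_lie_comb:
  fixes a c :: "nat \<Rightarrow> 'a::{comm_ring_1, real_algebra_1}"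
  obtains z where "bch L (lie_comb d L a) (lie_comb d L c) = lie_comb d L z"
  by (rule primitive_eq_lie_comb[of "bch L (lie_comb d L a) (lie_comb d L c)" d L])
     (auto intro: primitive_bch primitive_lie_comb bch_in_tens_space lie_comb_in_tens_space)

lemma lie_comb_in_free_lie: "lie_comb d L z \<in> free_lie d L"
  unfolding free_lie_iff
proof (intro allI impI)
  fix S assume S: "lie_subalgebra d L S" "\<forall>i\<in>{1..d}. tens_word [i] \<in> S"
  have basis: "lie_basis d L b \<in> S" if "b \<in> {1..lie_dim d L}" for b
  proof -
    have "lyndon_word d L b \<in> lyndon_words d L"
      using that bij_betw_lyndon_word bij_betwE by blast
    then show ?thesis unfolding lie_basis_eq
      by (intro lyndon_bracket_in_lie_subalgebra) (use S in \<open>auto simp: lyndon_words_def\<close>)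
  qed
  have "(\<lambda>v. \<Sum>b\<in>K. z b * lie_basis d L b v) \<in> S" if "finite K" "K \<subseteq> {1..lie_dim d L}" for K
    using that
  proof (induction K rule: finite_induct)
    case empty
    then show ?case using S(1) by (simp add: lie_subalgebra_def)
  next
    case (insert b K)
    then have "lie_basis d L b \<in> S" "(\<lambda>v. \<Sum>b\<in>K. z b * lie_basis d L b v) \<in> S" using basis by auto
    then show ?case using S(1) insert.hyps by (simp add: lie_subalgebra_def)
  qed
  then show "lie_comb d L z \<in> S" unfolding lie_comb_def by simp
qed

lemma lie_subalgebra_primitive: "lie_subalgebra d L {f. primitive f \<and> f \<in> tens_space d L}"
  unfolding lie_subalgebra_def
proof (intro conjI ballI allI)
  fix f g :: "real tens" 
  assume "f \<in> {f. primitive f \<and> f \<in> tens_space d L}" "g \<in> {f. primitive f \<and> f \<in> tens_space d L}"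
  then show "tens_bracket L f g \<in> {f. primitive f \<and> f \<in> tens_space d L}"
    using tens_mult_in_tens_space[of f d L g] tens_mult_in_tens_space[of g d L f]
    by (auto simp: primitive_bracket) (simp add: tens_bracket_def tens_space_iff)
qed (auto simp: tens_space_iff primitive_add primitive_mult_left)

text \<open>
  Lyndon brackets lie in every subalgebra that contains the letters; conversely the primitive tensors
  form such a subalgebra. The letters themselves need \<open>L \<ge> 1\<close>: for \<open>L = 0\<close> and \<open>d \<ge> 1\<close> no
  subalgebra contains them, and the hull is the set of all tensors.
\<close>

theorem free_lie_eq_lie_comb:
  assumes "L \<ge> 1"
  shows "free_lie d L = range (lie_comb d L)"
proof (intro equalityI subsetI)
  fix f assume "f \<in> free_lie d L"
  moreover have "tens_word [i] \<in> {f. primitive f \<and> f \<in> tens_space d L}" if "i \<in> {1..d}" for i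
    using that assms by (simp add: primitive_letter) (simp add: tens_space_def tens_word_def)
  ultimately have "primitive f" "f \<in> tens_space d L"
    using lie_subalgebra_primitive[of d L] unfolding free_lie_iff by blast+
  then show "f \<in> range (lie_comb d L)" by (rule primitive_eq_lie_comb) simp
qed (auto intro: lie_comb_in_free_lie)


section \<open>The Baker--Campbell--Hausdorff product by degree\<close>

lemma bch_Nil [simp]: "f [] = 0 \<Longrightarrow> g [] = 0 \<Longrightarrow> bch L f g [] = 0"
  by (simp add: bch_def tens_mult_def)

text \<open>
  The nonlinear part of \<open>bch\<close> at a word of length \<open>n\<close> depends on the arguments below length \<open>n\<close> only.
  This holds for each of the two exponentials, for the product and for the logarithm.
\<close>

lemma bch_top_degree:
  fixes f g f' g' :: "'a::{comm_ring_1, real_algebra_1} tens"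
  assumes "f [] = 0" "g [] = 0" "f' [] = 0" "g' [] = 0"
    and eq: "\<And>u. length u < length v \<Longrightarrow> f u = f' u" "\<And>u. length u < length v \<Longrightarrow> g u = g' u"
    and "length v \<le> L"
  shows "bch L f g v - f v - g v = bch L f' g' v - f' v - g' v"
proof (cases "v = []")
  case False
  let ?F = "tens_exp L f" and ?F' = "tens_exp L f'" and ?G = "tens_exp L g" and ?G' = "tens_exp L g'"
  let ?h = "tens_mult L ?F ?G" and ?h' = "tens_mult L ?F' ?G'"
  have FG: "?F u = ?F' u" "?G u = ?G' u" if "length u < length v" for u
    unfolding tens_exp_eq_series using that eq by (auto intro!: tens_series_cong_le)
  have h: "?h u = ?h' u" if "length u < length v" for u
    using that FG by (intro tens_mult_cong_le) auto
  have top: "?F v - f v = ?F' v - f' v" "?G v - g v = ?G' v - g' v"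
    using tens_series_cong_less[of f f' v L "fps_exp 1"] tens_series_cong_less[of g g' v L "fps_exp 1"] assms
    by (simp_all add: tens_exp_eq_series)
  have split: "tens_mult L a b v = a v + b v + (\<Sum>k\<in>{..length v} - {0, length v}. a (take k v) * b (drop k v))"
    if "a [] = 1" "b [] = 1" for a b :: "'a tens"
  proof -
    have "(\<Sum>k\<le>length v. a (take k v) * b (drop k v)) =
        (\<Sum>k\<in>{0, length v}. a (take k v) * b (drop k v)) +
        (\<Sum>k\<in>{..length v} - {0, length v}. a (take k v) * b (drop k v))"
      by (subst sum.subset_diff[of "{0, length v}"]) (auto simp: add.commute)
    then show ?thesis using that False assms(7) by (simp add: tens_mult_def add.commute)
  qed
  have "(\<Sum>k\<in>{..length v} - {0, length v}. ?F (take k v) * ?G (drop k v)) =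
      (\<Sum>k\<in>{..length v} - {0, length v}. ?F' (take k v) * ?G' (drop k v))"
    by (intro sum.cong refl) (auto simp: FG)
  then have "?h v - ?F v - ?G v = ?h' v - ?F' v - ?G' v"
    using split[of ?F ?G] split[of ?F' ?G'] assms by simp
  then have "(?h v - ?F v - ?G v) + (?F v - f v) + (?G v - g v) =
      (?h' v - ?F' v - ?G' v) + (?F' v - f' v) + (?G' v - g' v)"
    using top by (simp only:)
  then have *: "?h v - f v - g v = ?h' v - f' v - g' v" by (simp add: algebra_simps)
  have Nil: "?h [] = 1" "?h' [] = 1" using assms by (simp_all add: tens_mult_def)
  have "bch L f g v - fps_nth (fps_ln 1) 1 *\<^sub>R (?h v - tens_word [] v) =
      bch L f' g' v - fps_nth (fps_ln 1) 1 *\<^sub>R (?h' v - tens_word [] v)"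
    unfolding bch_def tens_log_eq_series
    by (rule tens_series_cong_less) (use h assms(7) Nil in \<open>auto simp: tens_word_def\<close>)
  then have "bch L f g v - ?h v = bch L f' g' v - ?h' v" by (simp add: fps_ln_nth algebra_simps)
  then have "(bch L f g v - ?h v) + (?h v - f v - g v) = (bch L f' g' v - ?h' v) + (?h' v - f' v - g' v)"
    using * by (simp only:)
  then show ?thesis by (simp add: algebra_simps)
qed (use assms in simp)

text \<open>
  Subalgebras are used to record in which variables the coefficients of a tensor are polynomials.
\<close>

definition subalgebra :: "'a::{comm_ring_1, real_algebra_1} set \<Rightarrow> bool" where
  "subalgebra S \<longleftrightarrow> additive_subgroup S \<and> 1 \<in> S \<and> (\<forall>x\<in>S. \<forall>y\<in>S. x * y \<in> S) \<and> (\<forall>r. \<forall>x\<in>S. r *\<^sub>R x \<in> S)"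

lemma subalgebra_additive [simp]: "subalgebra S \<Longrightarrow> additive_subgroup S"
  by (simp add: subalgebra_def)

lemma subalgebra_tens_word: "subalgebra S \<Longrightarrow> tens_word w v \<in> S"
  by (simp add: subalgebra_def tens_word_def additive_subgroup_def)

lemma subalgebra_tens_mult:
  assumes "subalgebra S" "\<And>v. f v \<in> S" "\<And>v. g v \<in> S"
  shows "tens_mult L f g v \<in> S"
proof -
  have "0 \<in> S" using assms(1) by (simp add: subalgebra_def additive_subgroup_def)
  moreover have "(\<Sum>k\<le>length v. f (take k v) * g (drop k v)) \<in> S"
    by (rule additive_subgroup_sum) (use assms in \<open>auto simp: subalgebra_def\<close>)
  ultimately show ?thesis by (simp add: tens_mult_def)
qed

lemma subalgebra_tens_series:
  assumes "subalgebra S" "\<And>v. f v \<in> S"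
  shows "tens_series L F f v \<in> S"
proof -
  have "tens_pow L f k v \<in> S" for k v
    by (induction k arbitrary: v) (auto intro: subalgebra_tens_word subalgebra_tens_mult assms)
  then show ?thesis unfolding tens_series_def
    by (intro additive_subgroup_sum) (use assms in \<open>auto simp: subalgebra_def\<close>)
qed

lemma subalgebra_bch:
  assumes S: "subalgebra S" and f: "\<And>v. f v \<in> S" and g: "\<And>v. g v \<in> S"
  shows "bch L f g v \<in> S"
  unfolding bch_def tens_log_eq_series
proof (rule subalgebra_tens_series[OF S])
  fix u
  have "tens_mult L (tens_exp L f) (tens_exp L g) u \<in> S"
    unfolding tens_exp_eq_series by (intro subalgebra_tens_mult subalgebra_tens_series S f g)
  then show "tens_mult L (tens_exp L f) (tens_exp L g) u - tens_word [] u \<in> S"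
    using subalgebra_tens_word[OF S, of "[]" u] S by (simp add: subalgebra_def additive_subgroup_def)
qed

lemma lie_comb_in_subgroup:
  assumes "additive_subgroup S" "\<And>b. b \<in> {1..lie_dim d L} \<Longrightarrow> z b \<in> S"
  shows "lie_comb d L z v \<in> S"
  unfolding lie_comb_def lie_basis_eq
  by (rule additive_subgroup_sum[OF assms(1)], subst lyndon_bracket_of_int,
      rule additive_subgroup_of_int) (use assms in auto)

section \<open>Change of coefficients\<close>

definition real_algebra_hom :: "('a::{comm_ring_1, real_algebra_1} \<Rightarrow> 'b::{comm_ring_1, real_algebra_1}) \<Rightarrow> bool" where
  "real_algebra_hom \<phi> \<longleftrightarrow> \<phi> 1 = 1 \<and> (\<forall>x y. \<phi> (x + y) = \<phi> x + \<phi> y) \<and>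
     (\<forall>x y. \<phi> (x * y) = \<phi> x * \<phi> y) \<and> (\<forall>r x. \<phi> (r *\<^sub>R x) = r *\<^sub>R \<phi> x)"

lemma real_algebra_hom_simps:
  assumes "real_algebra_hom \<phi>"
  shows "\<phi> 1 = 1" "\<phi> (x + y) = \<phi> x + \<phi> y" "\<phi> (x * y) = \<phi> x * \<phi> y" "\<phi> (r *\<^sub>R x) = r *\<^sub>R \<phi> x"
    "\<phi> 0 = 0" "\<phi> (x - y) = \<phi> x - \<phi> y" "\<phi> (of_int k) = of_int k"
proof -
  show *: "\<phi> 1 = 1" "\<phi> (x + y) = \<phi> x + \<phi> y" "\<phi> (x * y) = \<phi> x * \<phi> y" "\<phi> (r *\<^sub>R x) = r *\<^sub>R \<phi> x" for x y r
    using assms by (simp_all add: real_algebra_hom_def)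
  show "\<phi> 0 = 0" using *(4)[of 0 0] by simp
  show "\<phi> (x - y) = \<phi> x - \<phi> y" using *(2)[of "x - y" y] by simp
  have "of_int k = (of_int k :: real) *\<^sub>R (1 :: 'c::{comm_ring_1, real_algebra_1})" for k
    by (simp add: scaleR_conv_of_real)
  then show "\<phi> (of_int k) = of_int k" by (metis *(1) *(4))
qed

lemma real_algebra_hom_sum:
  assumes "real_algebra_hom \<phi>"
  shows "\<phi> (sum f A) = (\<Sum>x\<in>A. \<phi> (f x))"
  by (induction A rule: infinite_finite_induct) (simp_all add: real_algebra_hom_simps[OF assms])

lemma tens_series_hom:
  assumes "real_algebra_hom \<phi>"
  shows "tens_series L F (\<lambda>u. \<phi> (f u)) v = \<phi> (tens_series L F f v)"
proof -
  have "tens_pow L (\<lambda>u. \<phi> (f u)) k = (\<lambda>v. \<phi> (tens_pow L f k v))" for k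
  proof (induction k)
    case 0
    then show ?case by (auto simp: tens_word_def real_algebra_hom_simps[OF assms])
  next
    case (Suc k)
    show ?case by (rule ext) (simp add: Suc tens_mult_hom real_algebra_hom_simps[OF assms])
  qed
  then show ?thesis
    by (simp add: tens_series_def real_algebra_hom_sum[OF assms] real_algebra_hom_simps[OF assms])
qed

lemma bch_hom:
  assumes "real_algebra_hom \<phi>"
  shows "bch L (\<lambda>u. \<phi> (f u)) (\<lambda>u. \<phi> (g u)) v = \<phi> (bch L f g v)"
proof -
  have exp: "tens_exp L (\<lambda>u. \<phi> (f u)) = (\<lambda>u. \<phi> (tens_exp L f u))" for f
    unfolding tens_exp_eq_series by (rule ext) (rule tens_series_hom[OF assms])
  have mult: "tens_mult L (\<lambda>u. \<phi> (f u)) (\<lambda>u. \<phi> (g u)) = (\<lambda>u. \<phi> (tens_mult L f g u))" for f g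
    by (rule ext, rule tens_mult_hom) (simp_all add: real_algebra_hom_simps[OF assms])
  have one: "\<phi> a - tens_word [] u = \<phi> (a - tens_word [] u)" for a u
    by (simp add: tens_word_def real_algebra_hom_simps[OF assms])
  show ?thesis unfolding bch_def exp mult tens_log_eq_series one by (rule tens_series_hom[OF assms])
qed

lemma lie_comb_hom:
  assumes "real_algebra_hom \<phi>"
  shows "lie_comb d L (\<lambda>b. \<phi> (z b)) = (\<lambda>v. \<phi> (lie_comb d L z v))"
proof
  fix v
  have "\<phi> (lie_basis d L b v) = lie_basis d L b v" for b
    unfolding lie_basis_eq
    by (subst (1 2) lyndon_bracket_of_int) (rule real_algebra_hom_simps(7)[OF assms])
  then show "lie_comb d L (\<lambda>b. \<phi> (z b)) v = \<phi> (lie_comb d L z v)"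
    by (simp add: lie_comb_def real_algebra_hom_sum[OF assms] real_algebra_hom_simps[OF assms])
qed

section \<open>Evaluation of polynomials\<close>

lemma rpoly_vars_diff: "rpoly_vars (p - q) \<subseteq> rpoly_vars p \<union> rpoly_vars q"
  unfolding rpoly_vars_def using keys_diff[of p q] by blast

lemma rpoly_vars_mult: "rpoly_vars (p * q) \<subseteq> rpoly_vars p \<union> rpoly_vars q"
proof
  fix x assume "x \<in> rpoly_vars (p * q)"
  then obtain a b where "a \<in> Poly_Mapping.keys p" "b \<in> Poly_Mapping.keys q" "x \<in> Poly_Mapping.keys (a + b)"
    unfolding rpoly_vars_def using keys_mult[of p q] by blast
  then show "x \<in> rpoly_vars p \<union> rpoly_vars q"
    unfolding rpoly_vars_def using Poly_Mapping.keys_add[of a b] by blast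
qed

lemma rpoly_vars_scaleR: "rpoly_vars (r *\<^sub>R p) \<subseteq> rpoly_vars p"
proof -
  have "Poly_Mapping.keys (r *\<^sub>R p) \<subseteq> Poly_Mapping.keys p"
    by (auto simp: in_keys_iff scaleR_poly_mapping.rep_eq)
  then show ?thesis unfolding rpoly_vars_def by blast
qed

lemma rpoly_vars_0: "rpoly_vars 0 = {}"
  by (simp add: rpoly_vars_def)

lemma rpoly_vars_1: "rpoly_vars 1 = {}"
  unfolding rpoly_vars_def keys_one by simp

lemma rpoly_vars_var: "rpoly_vars (rpoly_var x) = {x}"
  by (simp add: rpoly_vars_def rpoly_var_def)

lemma subalgebra_rpoly_vars: "subalgebra {p. rpoly_vars p \<subseteq> V}"
proof -
  have "rpoly_vars (p - q) \<subseteq> V" "rpoly_vars (p * q) \<subseteq> V"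
    if "rpoly_vars p \<subseteq> V" "rpoly_vars q \<subseteq> V" for p q :: "'a rpoly"
    using that rpoly_vars_diff[of p q] rpoly_vars_mult[of p q] by blast+
  moreover have "rpoly_vars (r *\<^sub>R p) \<subseteq> V" if "rpoly_vars p \<subseteq> V" for r and p :: "'a rpoly"
    using that rpoly_vars_scaleR[of r p] by blast
  ultimately show ?thesis
    unfolding subalgebra_def additive_subgroup_def using rpoly_vars_0 rpoly_vars_1
    by (metis empty_subsetI mem_Collect_eq)
qed

definition monom_eval :: "('v \<Rightarrow> real) \<Rightarrow> ('v \<Rightarrow>\<^sub>0 nat) \<Rightarrow> real" where
  "monom_eval \<sigma> \<alpha> = (\<Prod>x\<in>Poly_Mapping.keys \<alpha>. \<sigma> x ^ Poly_Mapping.lookup \<alpha> x)"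

text \<open>
  Additivity and multiplicativity are proved after extending products and sums to common finite index
  sets, which avoids case distinctions on vanishing coefficients.
\<close>

lemma monom_eval_superset:
  assumes "finite K" "Poly_Mapping.keys \<alpha> \<subseteq> K"
  shows "monom_eval \<sigma> \<alpha> = (\<Prod>x\<in>K. \<sigma> x ^ Poly_Mapping.lookup \<alpha> x)"
  unfolding monom_eval_def
  by (rule prod.mono_neutral_left) (use assms in \<open>auto simp: in_keys_iff\<close>)

lemma monom_eval_add: "monom_eval \<sigma> (\<alpha> + \<beta>) = monom_eval \<sigma> \<alpha> * monom_eval \<sigma> \<beta>"
  using Poly_Mapping.keys_add[of \<alpha> \<beta>]
  by (simp add: monom_eval_superset[of "Poly_Mapping.keys \<alpha> \<union> Poly_Mapping.keys \<beta>"]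
      lookup_add power_add prod.distrib)

lemma rpoly_eval_superset:
  assumes "finite K" "Poly_Mapping.keys p \<subseteq> K"
  shows "rpoly_eval \<sigma> p = (\<Sum>\<alpha>\<in>K. Poly_Mapping.lookup p \<alpha> * monom_eval \<sigma> \<alpha>)"
  unfolding rpoly_eval_def monom_eval_def
  by (rule sum.mono_neutral_left) (use assms in \<open>auto simp: in_keys_iff\<close>)

lemma rpoly_eval_add: "rpoly_eval \<sigma> (p + q) = rpoly_eval \<sigma> p + rpoly_eval \<sigma> q"
  using Poly_Mapping.keys_add[of p q]
  by (simp add: rpoly_eval_superset[of "Poly_Mapping.keys p \<union> Poly_Mapping.keys q"]
      lookup_add distrib_right sum.distrib)

lemma rpoly_eval_scaleR: "rpoly_eval \<sigma> (r *\<^sub>R p) = r * rpoly_eval \<sigma> p"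
proof -
  have "Poly_Mapping.keys (r *\<^sub>R p) \<subseteq> Poly_Mapping.keys p"
    by (auto simp: in_keys_iff scaleR_poly_mapping.rep_eq)
  then show ?thesis
    by (simp add: rpoly_eval_superset[of "Poly_Mapping.keys p"] scaleR_poly_mapping.rep_eq
        sum_distrib_left mult.assoc)
qed

lemma rpoly_eval_single: "rpoly_eval \<sigma> (Poly_Mapping.single \<alpha> c) = c * monom_eval \<sigma> \<alpha>"
  by (simp add: rpoly_eval_superset[of "{\<alpha>}"])

lemma rpoly_eval_sum: "rpoly_eval \<sigma> (sum f A) = (\<Sum>x\<in>A. rpoly_eval \<sigma> (f x))"
  by (induction A rule: infinite_finite_induct) (simp_all add: rpoly_eval_add, simp_all add: rpoly_eval_def)

lemma poly_mapping_sum_single: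
  "p = (\<Sum>\<alpha>\<in>Poly_Mapping.keys p. Poly_Mapping.single \<alpha> (Poly_Mapping.lookup p \<alpha>))"
  by (rule poly_mapping_eqI) (auto simp: lookup_sum lookup_single when_def in_keys_iff)

lemma rpoly_eval_mult: "rpoly_eval \<sigma> (p * q) = rpoly_eval \<sigma> p * rpoly_eval \<sigma> q"
proof -
  have "p * q = (\<Sum>\<alpha>\<in>Poly_Mapping.keys p. \<Sum>\<beta>\<in>Poly_Mapping.keys q.
      Poly_Mapping.single (\<alpha> + \<beta>) (Poly_Mapping.lookup p \<alpha> * Poly_Mapping.lookup q \<beta>))"
    by (subst poly_mapping_sum_single[of p], subst poly_mapping_sum_single[of q])
       (simp add: sum_product mult_single)
  then show ?thesis
    by (simp add: rpoly_eval_sum rpoly_eval_single monom_eval_add sum_product ac_simps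
        rpoly_eval_superset[of "Poly_Mapping.keys p" p] rpoly_eval_superset[of "Poly_Mapping.keys q" q])
qed

lemma rpoly_eval_var [simp]: "rpoly_eval \<sigma> (rpoly_var x) = \<sigma> x"
  by (simp add: rpoly_var_def rpoly_eval_single monom_eval_def)

lemma real_algebra_hom_rpoly_eval: "real_algebra_hom (rpoly_eval \<sigma>)"
proof -
  have "rpoly_eval \<sigma> 1 = 1" using rpoly_eval_single[of \<sigma> 0 1] by (simp add: monom_eval_def)
  then show ?thesis
    by (simp add: real_algebra_hom_def rpoly_eval_add rpoly_eval_mult rpoly_eval_scaleR)
qed

lemma rpoly_eval_cong:
  assumes "\<And>x. x \<in> rpoly_vars p \<Longrightarrow> \<sigma> x = \<tau> x"
  shows "rpoly_eval \<sigma> p = rpoly_eval \<tau> p"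
  unfolding rpoly_eval_def
proof (intro sum.cong prod.cong refl arg_cong2[where f = "(*)"])
  fix \<alpha> x assume "\<alpha> \<in> Poly_Mapping.keys p" "x \<in> Poly_Mapping.keys \<alpha>"
  then have "\<sigma> x = \<tau> x" by (intro assms) (auto simp: rpoly_vars_def)
  then show "\<sigma> x ^ Poly_Mapping.lookup \<alpha> x = \<tau> x ^ Poly_Mapping.lookup \<alpha> x" by simp
qed

section \<open>The Baker--Campbell--Hausdorff polynomials\<close>

lemma lie_basis_length:
  assumes "b \<in> {1..lie_dim d L}" "lie_basis d L b v \<noteq> (0 :: 'a::comm_ring_1)"
  shows "length v = length (lyndon_word d L b)"
proof -
  have "lyndon_word d L b \<in> lyndon_words d L"
    using assms bij_betw_lyndon_word bij_betwE by blast
  then show ?thesis using lyndon_bracket_support(2) assms(2)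
    unfolding lie_basis_eq lyndon_words_def by blast
qed

text \<open>
  Truncating the coordinates of long basis words truncates the tensor by length, since each basis element
  is homogeneous.
\<close>

lemma lie_comb_cutoff:
  fixes z :: "nat \<Rightarrow> 'a::comm_ring_1"
  shows "lie_comb d L (\<lambda>b. if length (lyndon_word d L b) < n then z b else 0) v =
    (if length v < n then lie_comb d L z v else 0)"
proof -
  have "(if length (lyndon_word d L b) < n then z b else 0) * lie_basis d L b v =
      (if length v < n then z b * lie_basis d L b v else 0)" if "b \<in> {1..lie_dim d L}" for b
    using lie_basis_length[OF that, of v, where 'a = 'a] by (cases "lie_basis d L b v = (0 :: 'a)") auto
  then show ?thesis by (simp add: lie_comb_def)
qed

text \<open>
  With \<open>n\<close> the length of the \<open>j\<close>-th basis word, let \<open>X'\<close> and \<open>Y'\<close> be the parts of \<open>X\<close> and \<open>Y\<close> of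
  length below \<open>n\<close>. They involve variables of index below \<open>j\<close>, and in degree \<open>n\<close> the tensors
  \<open>bch L X Y - X - Y\<close> and \<open>bch L X' Y'\<close> agree. Hence the coefficients of the former lie in the subring
  generated by those variables, and so do its coordinates.
\<close>

theorem bch_coordinate_lower_variables:
  fixes z :: "nat \<Rightarrow> (nat + nat) rpoly"
  assumes z: "bch L (lie_comb d L (\<lambda>b. rpoly_var (Inl b))) (lie_comb d L (\<lambda>b. rpoly_var (Inr b))) = lie_comb d L z"
    and j: "j \<in> {1..lie_dim d L}"
  shows "rpoly_vars (z j - rpoly_var (Inl j) - rpoly_var (Inr j)) \<subseteq> Inl ` {1..<j} \<union> Inr ` {1..<j}"
proof -
  let ?V = "Inl ` {1..<j} \<union> Inr ` {1..<j} :: (nat + nat) set"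
  let ?S = "{p. rpoly_vars p \<subseteq> ?V}"
  let ?n = "length (lyndon_word d L j)"
  let ?X = "lie_comb d L (\<lambda>b. rpoly_var (Inl b)) :: (nat + nat) rpoly tens"
  let ?Y = "lie_comb d L (\<lambda>b. rpoly_var (Inr b)) :: (nat + nat) rpoly tens"
  let ?X' = "lie_comb d L (\<lambda>b. if length (lyndon_word d L b) < ?n then rpoly_var (Inl b) else 0) :: (nat + nat) rpoly tens"
  let ?Y' = "lie_comb d L (\<lambda>b. if length (lyndon_word d L b) < ?n then rpoly_var (Inr b) else 0) :: (nat + nat) rpoly tens"
  have S: "subalgebra ?S" by (rule subalgebra_rpoly_vars)
  have S0: "0 \<in> ?S" using S by (simp add: subalgebra_def additive_subgroup_def)
  have nL: "?n \<le> L"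
    using j bij_betw_lyndon_word[of d L] bij_betwE unfolding lyndon_words_def by blast
  have X': "?X' v \<in> ?S" for v
    by (rule lie_comb_in_subgroup) (use S S0 lyndon_word_length_less[OF _ j] in \<open>auto simp: rpoly_vars_var\<close>)
  have Y': "?Y' v \<in> ?S" for v
    by (rule lie_comb_in_subgroup) (use S S0 lyndon_word_length_less[OF _ j] in \<open>auto simp: rpoly_vars_var\<close>)
  have "z j - rpoly_var (Inl j) - rpoly_var (Inr j) \<in> ?S"
  proof (rule lie_comb_coefficients_in[where z = "\<lambda>b. z b - rpoly_var (Inl b) - rpoly_var (Inr b)"])
    show "additive_subgroup ?S" using S by simp
    show "lie_comb d L (\<lambda>b. z b - rpoly_var (Inl b) - rpoly_var (Inr b)) v \<in> ?S" if v: "length v = ?n" for v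
    proof -
      have "lie_comb d L (\<lambda>b. z b - rpoly_var (Inl b) - rpoly_var (Inr b)) v = bch L ?X ?Y v - ?X v - ?Y v"
        unfolding z by (simp add: lie_comb_def left_diff_distrib sum_subtractf)
      also have "\<dots> = bch L ?X' ?Y' v - ?X' v - ?Y' v"
        by (rule bch_top_degree) (use v nL in \<open>auto simp: lie_comb_cutoff\<close>)
      also have "\<dots> = bch L ?X' ?Y' v" using v by (simp add: lie_comb_cutoff)
      also have "\<dots> \<in> ?S" by (rule subalgebra_bch[OF S X' Y'])
      finally show ?thesis .
    qed
  qed (use j in auto)
  then show ?thesis by simp
qed

lemma bch_poly_coordinate:
  assumes "j \<in> {1..lie_dim d L}"
    and z: "bch L (lie_comb d L (\<lambda>b. rpoly_var (Inl b))) (lie_comb d L (\<lambda>b. rpoly_var (Inr b))) = lie_comb d L z"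
  shows "rpoly_vars (bch_poly d L j) \<subseteq> Inl ` {1..<j} \<union> Inr ` {1..<j}"
    and "z j = rpoly_var (Inl j) + rpoly_var (Inr j) + bch_poly d L j"
proof -
  have "bch_poly d L j = z j - rpoly_var (Inl j) - rpoly_var (Inr j)"
    unfolding bch_poly_def bch_def[symmetric] z lie_dual_lie_comb[OF assms(1)]
    by (rule the_equality) (use bch_coordinate_lower_variables[OF z assms(1)] in \<open>auto simp: algebra_simps\<close>)
  then show "rpoly_vars (bch_poly d L j) \<subseteq> Inl ` {1..<j} \<union> Inr ` {1..<j}"
    "z j = rpoly_var (Inl j) + rpoly_var (Inr j) + bch_poly d L j"
    using bch_coordinate_lower_variables[OF z assms(1)] by simp_all
qed

lemma rpoly_vars_bch_poly:
  assumes "j \<in> {1..lie_dim d L}"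
  shows "rpoly_vars (bch_poly d L j) \<subseteq> Inl ` {1..<j} \<union> Inr ` {1..<j}"
  by (rule bch_lie_comb[of L d "\<lambda>b. rpoly_var (Inl b) :: (nat + nat) rpoly" "\<lambda>b. rpoly_var (Inr b)"])
     (rule bch_poly_coordinate(1)[OF assms])

lemma bch_eval_cong:
  assumes "j \<in> {1..lie_dim d L}" "\<And>b. b \<in> {1..<j} \<Longrightarrow> a b = a' b"
  shows "bch_eval d L j a c = bch_eval d L j a' c"
  unfolding bch_eval_def
  by (rule rpoly_eval_cong) (use rpoly_vars_bch_poly[OF assms(1)] assms(2) in auto)

text \<open>
  The identity with indeterminate coefficients, specialized by the evaluation homomorphism.
\<close>

theorem bch_lie_comb_eval:
  "bch L (lie_comb d L a) (lie_comb d L c) = lie_comb d L (\<lambda>j. a j + c j + bch_eval d L j a c)"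
proof -
  obtain z where z: "bch L (lie_comb d L (\<lambda>b. rpoly_var (Inl b) :: (nat + nat) rpoly))
      (lie_comb d L (\<lambda>b. rpoly_var (Inr b))) = lie_comb d L z"
    by (rule bch_lie_comb)
  let ?\<phi> = "rpoly_eval (case_sum a c)"
  note hom = real_algebra_hom_rpoly_eval[of "case_sum a c"]
  have "bch L (lie_comb d L a) (lie_comb d L c) =
      bch L (lie_comb d L (\<lambda>b. ?\<phi> (rpoly_var (Inl b)))) (lie_comb d L (\<lambda>b. ?\<phi> (rpoly_var (Inr b))))"
    by simp
  also have "\<dots> = lie_comb d L (\<lambda>b. ?\<phi> (z b))"
    unfolding lie_comb_hom[OF hom] bch_hom[OF hom, abs_def] z ..
  also have "\<dots> = lie_comb d L (\<lambda>j. a j + c j + bch_eval d L j a c)"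
  proof (rule lie_comb_cong)
    fix j assume j: "j \<in> {1..lie_dim d L}"
    have "?\<phi> (bch_poly d L j) = bch_eval d L j a c"
      unfolding bch_eval_def
      by (rule rpoly_eval_cong) (use rpoly_vars_bch_poly[OF j] in auto)
    then show "?\<phi> (z j) = a j + c j + bch_eval d L j a c"
      by (simp add: bch_poly_coordinate(2)[OF j z] rpoly_eval_add)
  qed
  finally show ?thesis .
qed


section \<open>Inverses in the group\<close>

lemma lie_comb_uminus: "lie_comb d L (\<lambda>b. - z b) = (\<lambda>v. - lie_comb d L z v)"
  by (auto simp: lie_comb_def sum_negf)

lemma carrier_lie_group: "L \<ge> 1 \<Longrightarrow> carrier (lie_group d L) = range (\<lambda>z. tens_exp L (lie_comb d L z))"
  by (simp add: lie_group_def free_lie_eq_lie_comb image_image)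

lemma inv_lie_group:
  assumes "L \<ge> 1"
  shows "inv\<^bsub>lie_group d L\<^esub> (tens_exp L (lie_comb d L m)) = tens_exp L (lie_comb d L (\<lambda>b. - m b))"
    (is "inv\<^bsub>_\<^esub> ?e = ?e'")
proof -
  have inv: "tens_mult L ?e ?e' = tens_word []" "tens_mult L ?e' ?e = tens_word []"
    unfolding lie_comb_uminus by (rule tens_exp_inverse, simp)+
  show ?thesis unfolding m_inv_def
  proof (rule the_equality)
    show "?e' \<in> carrier (lie_group d L) \<and> ?e \<otimes>\<^bsub>lie_group d L\<^esub> ?e' = \<one>\<^bsub>lie_group d L\<^esub> \<and>
        ?e' \<otimes>\<^bsub>lie_group d L\<^esub> ?e = \<one>\<^bsub>lie_group d L\<^esub>"
      using inv carrier_lie_group[OF assms] by (auto simp: lie_group_def)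
  next
    fix y assume y: "y \<in> carrier (lie_group d L) \<and> ?e \<otimes>\<^bsub>lie_group d L\<^esub> y = \<one>\<^bsub>lie_group d L\<^esub> \<and>
        y \<otimes>\<^bsub>lie_group d L\<^esub> ?e = \<one>\<^bsub>lie_group d L\<^esub>"
    show "y = ?e'"
    proof
      fix v
      show "y v = ?e' v"
      \<comment> \<open>A left inverse of \<open>?e\<close> equals each right inverse; beyond length \<open>L\<close> both sides vanish.\<close>
      proof (cases "length v \<le> L")
        case True
        have "y v = tens_mult L (tens_mult L ?e' ?e) y v"
          using True by (simp add: inv tens_mult_one_left)
        also have "\<dots> = tens_mult L ?e' (tens_mult L ?e y) v" by (simp add: tens_mult_assoc)
        also have "\<dots> = ?e' v" using y True by (simp add: lie_group_def tens_mult_one_right)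
        finally show ?thesis .
      next
        case False
        then show ?thesis using y by (auto simp: lie_group_def tens_exp_eq_series)
      qed
    qed
  qed
qed

lemma log_inv_mult_exp:
  assumes "L \<ge> 1"
  shows "tens_log L (inv\<^bsub>lie_group d L\<^esub> (tens_exp L (lie_comb d L m)) \<otimes>\<^bsub>lie_group d L\<^esub>
      tens_exp L (lie_comb d L c)) =
    lie_comb d L (\<lambda>j. - m j + c j + bch_eval d L j (\<lambda>b. - m b) c)"
  unfolding inv_lie_group[OF assms] bch_lie_comb_eval[symmetric] bch_def by (simp add: lie_group_def)

section \<open>Finitely supported measures\<close>

lemma measurable_tens_mult:
  fixes F G :: "'b \<Rightarrow> real tens"
  assumes "\<And>u. (\<lambda>x. F x u) \<in> borel_measurable M" "\<And>u. (\<lambda>x. G x u) \<in> borel_measurable M"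
  shows "(\<lambda>x. tens_mult L (F x) (G x) v) \<in> borel_measurable M"
  using assms by (cases "length v \<le> L") (simp_all add: tens_mult_def)

lemma measurable_tens_log:
  fixes F :: "'b \<Rightarrow> real tens"
  assumes "\<And>u. (\<lambda>x. F x u) \<in> borel_measurable M"
  shows "(\<lambda>x. tens_log L (F x) v) \<in> borel_measurable M"
proof -
  have "(\<lambda>x. tens_pow L (\<lambda>u. F x u - tens_word [] u) k v) \<in> borel_measurable M" for k v
  proof (induction k arbitrary: v)
    case (Suc k)
    then show ?case unfolding tens_pow.simps by (intro measurable_tens_mult) (use assms in auto)
  qed simp
  then show ?thesis unfolding tens_log_def by simp
qed

lemma (in prob_space) has_bochner_integral_finite_support:
  fixes g :: "'a \<Rightarrow> real"
  assumes "finite S" "\<And>s. s \<in> S \<Longrightarrow> {s} \<in> events" "prob S = 1" "g \<in> borel_measurable M"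
  shows "has_bochner_integral M g (\<Sum>s\<in>S. prob {s} * g s)"
proof -
  let ?h = "\<lambda>y. \<Sum>s\<in>S. indicator {s} y * g s"
  have "has_bochner_integral M ?h (\<Sum>s\<in>S. prob {s} * g s)"
    using assms(2)
    by (intro has_bochner_integral_sum has_bochner_integral_mult_left has_bochner_integral_real_indicator)
       (auto simp: emeasure_eq_measure)
  moreover have "AE y in M. g y = ?h y"
  proof -
    have "AE y in M. y \<in> S" using assms(3) by (rule AE_prob_1)
    then show ?thesis
    proof (rule AE_mp, intro AE_I2 impI)
      fix y assume "y \<in> S"
      then show "g y = ?h y" using assms(1) by (simp add: indicator_def if_distrib[where f = "\<lambda>a. a * _"] cong: if_cong)
    qed
  qed
  moreover have "?h \<in> borel_measurable M" using assms(2) by simp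
  ultimately show ?thesis using has_bochner_integral_cong_AE[OF assms(4)] by blast
qed

text \<open>
  The points may repeat: a sum over indices counts a repeated point several times, a sum over the image
  once. As the weights are nonnegative, equality of the two totals forces weight zero on repeated points.
\<close>

lemma sum_weights_image:
  fixes p :: "'b \<Rightarrow> real"
  assumes "finite I" "\<And>y. p y \<ge> 0" "\<And>i. i \<in> I \<Longrightarrow> p (x i) = w i"
    and "(\<Sum>i\<in>I. w i) = (\<Sum>y\<in>x ` I. p y)"
  shows "(\<Sum>y\<in>x ` I. p y * h y) = (\<Sum>i\<in>I. w i * h (x i))"
proof -
  define n where "n y = card {i \<in> I. x i = y}" for y
  have sum: "(\<Sum>i\<in>I. w i * g (x i)) = (\<Sum>y\<in>x ` I. real (n y) * (p y * g y))" for g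
  proof -
    have "(\<Sum>i\<in>I. w i * g (x i)) = (\<Sum>y\<in>x ` I. \<Sum>i\<in>{i \<in> I. x i = y}. w i * g (x i))"
      by (rule sum.image_gen[OF assms(1)])
    also have "\<dots> = (\<Sum>y\<in>x ` I. \<Sum>i\<in>{i \<in> I. x i = y}. p y * g y)"
      by (intro sum.cong refl) (auto simp: assms(3))
    finally show ?thesis by (simp add: n_def)
  qed
  have n: "n y \<ge> 1" if "y \<in> x ` I" for y
  proof -
    have "{i \<in> I. x i = y} \<noteq> {}" using that by auto
    then have "n y \<noteq> 0" using assms(1) by (simp add: n_def)
    then show ?thesis by simp
  qed
  have "(\<Sum>y\<in>x ` I. (real (n y) - 1) * p y) = 0"
    using sum[of "\<lambda>_. 1"] assms(4) by (simp add: left_diff_distrib sum_subtractf)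
  then have "(real (n y) - 1) * p y = 0" if "y \<in> x ` I" for y
    using that n assms(1,2) by (subst (asm) sum_nonneg_eq_0_iff) (auto simp del: mult_eq_0_iff)
  then have "p y * h y = real (n y) * (p y * h y)" if "y \<in> x ` I" for y
    using that by fastforce
  then show ?thesis unfolding sum by (intro sum.cong) auto
qed

section \<open>The recursion for the group mean\<close>

lemma recursion_solution_exists:
  fixes F :: "nat \<Rightarrow> (nat \<Rightarrow> 'a) \<Rightarrow> 'a"
  assumes "\<And>j m m'. j \<in> {1..n} \<Longrightarrow> (\<And>b. b \<in> {1..<j} \<Longrightarrow> m b = m' b) \<Longrightarrow> F j m = F j m'"
  shows "\<exists>m. \<forall>j\<in>{1..n}. m j = F j m"
proof -
  have "\<exists>m. \<forall>j\<in>{1..k}. m j = F j m" if "k \<le> n" for k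
    using that
  proof (induction k)
    case (Suc k)
    then obtain m where m: "\<forall>j\<in>{1..k}. m j = F j m" by auto
    define m' where "m' = m(Suc k := F (Suc k) m)"
    have eq: "F j m' = F j m" if "j \<in> {1..Suc k}" for j
      by (rule assms) (use that Suc.prems in \<open>auto simp: m'_def\<close>)
    have "m' j = F j m'" if "j \<in> {1..Suc k}" for j
      using m that unfolding eq[OF that] by (cases "j = Suc k") (auto simp: m'_def)
    then show ?case by blast
  qed simp
  then show ?thesis by blast
qed

lemma recursion_solution_unique:
  fixes F :: "nat \<Rightarrow> (nat \<Rightarrow> 'a) \<Rightarrow> 'a"
  assumes "\<And>j m m'. j \<in> {1..n} \<Longrightarrow> (\<And>b. b \<in> {1..<j} \<Longrightarrow> m b = m' b) \<Longrightarrow> F j m = F j m'"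
    and "\<forall>j\<in>{1..n}. m j = F j m" "\<forall>j\<in>{1..n}. m' j = F j m'" "j \<in> {1..n}"
  shows "m j = m' j"
  using assms(4)
proof (induction j rule: less_induct)
  case (less j)
  have "F j m = F j m'" by (rule assms(1)) (use less in auto)
  then show ?case using assms(2,3) less.prems by auto
qed

text \<open>
  The integral is the coefficientwise average of \<open>log (m\<^sup>-\<^sup>1 x\<^sub>i)\<close>, and its coordinates are the averages of
  \<open>- m\<^sub>j + c\<^sub>i\<^sub>j + p\<^sub>j (- m, c\<^sub>i)\<close>. By linear independence it is zero exactly when its coordinates are.
\<close>

lemma is_group_mean_iff_recursion:
  fixes N :: nat and \<nu> :: "real tens measure"
  assumes L: "L \<ge> 1"
    and \<nu>: "prob_space \<nu>" "sets \<nu> = sets (restrict_space borel (carrier (lie_group d L)))"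
    and supp: "measure \<nu> (x ` {1..N}) = 1"
    and w: "\<And>i. i \<in> {1..N} \<Longrightarrow> measure \<nu> {x i} = w i" "(\<Sum>i=1..N. w i) = 1"
    and x: "\<And>i. i \<in> {1..N} \<Longrightarrow> x i = tens_exp L (lie_comb d L (c i))"
  shows "is_group_mean d L \<nu> (tens_exp L (lie_comb d L m)) \<longleftrightarrow>
    (\<forall>j\<in>{1..lie_dim d L}. m j = (\<Sum>i=1..N. w i * (c i j + bch_eval d L j (\<lambda>b. - m b) (c i))))"
proof -
  interpret prob_space \<nu> by (rule \<nu>(1))
  let ?G = "lie_group d L"
  let ?e = "tens_exp L (lie_comb d L m)"
  let ?g = "\<lambda>y. tens_log L (inv\<^bsub>?G\<^esub> ?e \<otimes>\<^bsub>?G\<^esub> y)"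
  let ?z = "\<lambda>i j. - m j + c i j + bch_eval d L j (\<lambda>b. - m b) (c i)"
  have meas: "(\<lambda>y. ?g y v) \<in> borel_measurable \<nu>" for v
  proof -
    have coord: "(\<lambda>y::real tens. y u) \<in> borel_measurable \<nu>" for u
    proof -
      have "(\<lambda>y::real tens. y u) \<in> borel_measurable borel"
        by (intro borel_measurable_continuous_onI continuous_on_product_coordinates)
      then show ?thesis
        using measurable_cong_sets[OF \<nu>(2) refl] measurable_restrict_space1 by blast
    qed
    show ?thesis unfolding lie_group_def monoid.simps
      by (intro measurable_tens_log measurable_tens_mult coord) simp
  qed
  have sing: "{x i} \<in> events" if "i \<in> {1..N}" for i
  proof -
    have "x i \<in> carrier ?G" using x[OF that] carrier_lie_group[OF L] by auto
    then show ?thesis unfolding \<nu>(2) sets_restrict_space by (auto intro!: image_eqI[of _ _ "{x i}"])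
  qed
  have weights: "(\<Sum>y\<in>x ` {1..N}. prob {y}) = 1"
  proof -
    have "prob (x ` {1..N}) = (\<Sum>y\<in>x ` {1..N}. prob {y})"
      by (rule finite_measure_eq_sum_singleton) (use sing in auto)
    then show ?thesis using supp by simp
  qed
  have integral: "has_bochner_integral \<nu> (\<lambda>y. ?g y v) (lie_comb d L (\<lambda>j. \<Sum>i=1..N. w i * ?z i j) v)" for v
  proof -
    have "has_bochner_integral \<nu> (\<lambda>y. ?g y v) (\<Sum>y\<in>x ` {1..N}. prob {y} * ?g y v)"
      by (rule has_bochner_integral_finite_support) (use sing supp meas in auto)
    also have "(\<Sum>y\<in>x ` {1..N}. prob {y} * ?g y v) = (\<Sum>i=1..N. w i * ?g (x i) v)"
      by (rule sum_weights_image) (use w weights in auto)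
    also have "\<dots> = (\<Sum>i=1..N. w i * lie_comb d L (?z i) v)"
      by (intro sum.cong refl) (simp add: x log_inv_mult_exp[OF L])
    also have "\<dots> = lie_comb d L (\<lambda>j. \<Sum>i=1..N. w i * ?z i j) v"
      unfolding lie_comb_def sum_distrib_left sum_distrib_right
      by (subst sum.swap) (simp add: mult.assoc)
    finally show ?thesis .
  qed
  have "is_group_mean d L \<nu> ?e \<longleftrightarrow> (\<forall>v. has_bochner_integral \<nu> (\<lambda>y. ?g y v) 0)"
    using carrier_lie_group[OF L] by (auto simp: is_group_mean_def)
  also have "\<dots> \<longleftrightarrow> (\<forall>v. lie_comb d L (\<lambda>j. \<Sum>i=1..N. w i * ?z i j) v = 0)"
  proof (intro all_cong1 iffI)
    fix v assume "has_bochner_integral \<nu> (\<lambda>y. ?g y v) 0"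
    from has_bochner_integral_eq[OF integral[of v] this]
    show "lie_comb d L (\<lambda>j. \<Sum>i=1..N. w i * ?z i j) v = 0" .
  next
    fix v assume "lie_comb d L (\<lambda>j. \<Sum>i=1..N. w i * ?z i j) v = 0"
    with integral[of v] show "has_bochner_integral \<nu> (\<lambda>y. ?g y v) 0" by (simp only:)
  qed
  also have "\<dots> \<longleftrightarrow> lie_comb d L (\<lambda>j. \<Sum>i=1..N. w i * ?z i j) = lie_comb d L (\<lambda>j. 0)"
    by (auto simp: fun_eq_iff lie_comb_def)
  also have "\<dots> \<longleftrightarrow> (\<forall>j\<in>{1..lie_dim d L}. (\<Sum>i=1..N. w i * ?z i j) = 0)"
    using lie_comb_inject[of d L "\<lambda>j. \<Sum>i=1..N. w i * ?z i j" "\<lambda>j. 0"]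
      lie_comb_cong[of d L "\<lambda>j. \<Sum>i=1..N. w i * ?z i j" "\<lambda>j. 0"] by blast
  also have "\<dots> \<longleftrightarrow> (\<forall>j\<in>{1..lie_dim d L}. m j = (\<Sum>i=1..N. w i * (c i j + bch_eval d L j (\<lambda>b. - m b) (c i))))"
  proof (rule ball_cong[OF refl])
    fix j
    have "(\<Sum>i=1..N. w i * ?z i j) =
        (\<Sum>i=1..N. w i * (c i j + bch_eval d L j (\<lambda>b. - m b) (c i))) - (\<Sum>i=1..N. w i) * m j"
      unfolding sum_distrib_right sum_subtractf[symmetric]
      by (intro sum.cong refl) (simp add: algebra_simps)
    then show "(\<Sum>i=1..N. w i * ?z i j) = 0 \<longleftrightarrow>
        m j = (\<Sum>i=1..N. w i * (c i j + bch_eval d L j (\<lambda>b. - m b) (c i)))"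
      using w(2) by auto
  qed
  finally show ?thesis .
qed

theorem corollary17:
  fixes d L N :: nat
    and \<nu> :: "real tens measure"
    and x :: "nat \<Rightarrow> real tens"
    and w :: "nat \<Rightarrow> real"
    and c :: "nat \<Rightarrow> nat \<Rightarrow> real"
    and m :: "nat \<Rightarrow> real"
  assumes "d \<ge> 1" and "L \<ge> 1" and "N \<ge> 1"
    and "prob_space \<nu>"
    and "sets \<nu> = sets (restrict_space borel (carrier (lie_group d L)))"
    and "measure \<nu> (x ` {1..N}) = 1"
    and "\<forall>i\<in>{1..N}. measure \<nu> {x i} = w i"
    and "(\<Sum>i=1..N. w i) = 1"
    and "\<forall>i\<in>{1..N}. x i = tens_exp L (lie_comb d L (c i))"
    and "group_mean d L \<nu> = tens_exp L (lie_comb d L m)"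
  shows "\<forall>j\<in>{1..lie_dim d L}.
           m j = (\<Sum>i=1..N. w i * (c i j + bch_eval d L j (\<lambda>b. - m b) (c i)))"
proof -
  let ?F = "\<lambda>j m. \<Sum>i=1..N. w i * (c i j + bch_eval d L j (\<lambda>b. - m b) (c i))"
  have mean_iff: "is_group_mean d L \<nu> (tens_exp L (lie_comb d L m)) \<longleftrightarrow>
      (\<forall>j\<in>{1..lie_dim d L}. m j = ?F j m)" for m
    by (rule is_group_mean_iff_recursion) (use assms in auto)
  have cong: "?F j m = ?F j m'"
    if "j \<in> {1..lie_dim d L}" "\<And>b. b \<in> {1..<j} \<Longrightarrow> m b = m' b" for j m m'
    using bch_eval_cong[OF that(1), of "\<lambda>b. - m b" "\<lambda>b. - m' b"] that(2) by simp
  \<comment> \<open>The definite description in \<^const>\<open>group_mean\<close> is meaningful only once existence and uniqueness are known.\<close>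
  obtain m0 where m0: "\<forall>j\<in>{1..lie_dim d L}. m0 j = ?F j m0"
    using recursion_solution_exists[of "lie_dim d L" ?F, OF cong] by blast
  have "\<exists>!y. is_group_mean d L \<nu> y"
  proof (rule ex1I)
    show "is_group_mean d L \<nu> (tens_exp L (lie_comb d L m0))" using mean_iff m0 by blast
    fix y assume y: "is_group_mean d L \<nu> y"
    then obtain a where a: "y = tens_exp L (lie_comb d L a)"
      using carrier_lie_group[OF assms(2)] by (auto simp: is_group_mean_def)
    with y mean_iff have "\<forall>j\<in>{1..lie_dim d L}. a j = ?F j a" by blast
    then have "lie_comb d L a = lie_comb d L m0"
      using recursion_solution_unique[of "lie_dim d L" ?F, OF cong] m0 by (intro lie_comb_cong) blast
    then show "y = tens_exp L (lie_comb d L m0)" using a by simp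
  qed
  then have "is_group_mean d L \<nu> (group_mean d L \<nu>)" unfolding group_mean_def by (rule theI')
  then show ?thesis using mean_iff assms(10) by simp
qed


end
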